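(* For a positive integer $k\geq 2$, let $d=2k+1$. Then $\lambda:\mathbb{Z}_4^d/G_d\to\mathbb{R}$ defined by \begin{align*} \lambda_0=\lambda_{(2^d)}&=\frac{2^{2k-1}}{k+1},\\ \lambda_{(0^k,2^{k+1})}=\lambda_{(0^{k+1},2^k)}&=\frac{2^{2k-1}}{k+1}\cdot k,\\ \lambda_{(0^k,1,2^k)}&=\frac{2^{2k-1}}{k+1}\cdot(2k+2), \end{align*} and $\lambda_x=0$ for all other representatives $x\in\mathbb{Z}_4^d/G_d$, yields a feasible dual auxiliary function of the radialized discrete dual Cohn-Elkies linear program in $\mathbb{Z}_4^d$ with $r=2$; that is, with $\mu=\mathcal{F}^T\lambda$ (equivalently $\lambda=\mathcal{F}^T\mu$), the pair $(\mu,\lambda)$ is a feasible point of that program.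
   Context: $\mathbb{Z}_m$ denotes $\mathbb{Z}/m\mathbb{Z}$, with coset representatives $x$ satisfying $-m/2<x\leq m/2$. Using these representatives, $\mathbb{Z}_m^d$ is embedded in $\mathbb{Z}^d\subset\mathbb{R}^d$, and for $x,y\in\mathbb{Z}_m^d$, $|x|$ denotes the Euclidean norm of the representative of $x$ and $\langle x,y\rangle=x_1y_1+\cdots+x_dy_d$. The group $G_d=\mathbb{Z}_2^d\rtimes S_d$ acts on $\mathbb{Z}_m^d$ by permuting coordinates and changing the signs of coordinates; $x\sim y$ means that $x$ and $y$ lie in the same $G_d$-orbit, and $\mathbb{Z}_m^d/G_d$ is the set of orbits, identified with a set of representatives. For $m=4$, $(0^a,1^b,2^c)$ denotes the element $(0,\dots,0,1,\dots,1,2,\dots,2)\in\mathbb{Z}_4^d$ with $a$ zeros, $b$ ones and $c$ twos ($a+b+c=d$), where terms with no entries are omitted and an exponent of 1 may be dropped; these elements form a complete set of representatives of $\mathbb{Z}_4^d/G_d$. Also $0$ denotes $(0,\dots,0)$. The $G_d$-symmetrized discrete Fourier transform is the matrix $\mathcal{F}$ indexed by $\mathbb{Z}_m^d/G_d$ with entries $\mathcal{F}_{xy}=m^{-d/2}\sum_{z\sim y}e^{-\frac{2\pi i}{m}\langle x,z\rangle}$; it satisfies $\mathcal{F}^{-1}=\mathcal{F}$. For fixed $r>0$ and positive integers $m,d$, the radialized discrete dual Cohn-Elkies linear program in $\mathbb{Z}_m^d$ is: maximize $m^{-d/2}\lambda_0$ over all real vectors $\mu,\lambda$ indexed by $\mathbb{Z}_m^d/G_d$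 such that $\lambda_y\geq 0$ for all $y$; $\lambda=\mathcal{F}^T\mu$; $\mu_x\geq 0$ for all $|x|\geq r$; $\mu_x=0$ for all $0<|x|<r$; and $\mu_0=\left(\frac r2\right)^d$. A feasible $\mu$ (which determines $\lambda$, and conversely) is called a dual auxiliary function. *)

theory Defs
  imports "HOL-Analysis.Analysis"
begin

section \<open>The group \<open>\<int>\<^sub>m\<^sup>d\<close> with centred representatives\<close>

definition centred :: "nat \<Rightarrow> int set" where
  "centred m = {a. - real m / 2 < real_of_int a \<and> real_of_int a \<le> real m / 2}"

text \<open>The representative in \<open>(-m/2, m/2]\<close> of the class of an integer modulo \<open>m\<close>;
  see \<open>crep_eq_iff\<close> for the characterization.\<close>

definition crep :: "nat \<Rightarrow> int \<Rightarrow> int" where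
  "crep m a = int m div 2 - (int m div 2 - a) mod int m"

definition Zmd :: "nat \<Rightarrow> nat \<Rightarrow> (nat \<Rightarrow> int) set" where
  "Zmd m d = {..<d} \<rightarrow>\<^sub>E centred m"

definition znorm :: "nat \<Rightarrow> (nat \<Rightarrow> int) \<Rightarrow> real" where
  "znorm d x = L2_set (\<lambda>i. real_of_int (x i)) {..<d}"

definition zinner :: "nat \<Rightarrow> (nat \<Rightarrow> int) \<Rightarrow> (nat \<Rightarrow> int) \<Rightarrow> int" where
  "zinner d x y = (\<Sum>i<d. x i * y i)"


section \<open>Signed coordinate permutations and their orbits\<close>

text \<open>Signs need not preserve the centred representatives (\<open>-m/2\<close> is not one of them when
  \<open>m\<close> is even), so the result is reduced again.\<close>

definition signed_perm :: "nat \<Rightarrow> nat \<Rightarrow> (nat \<Rightarrow> int) \<Rightarrow> (nat \<Rightarrow> nat) \<Rightarrow> (nat \<Rightarrow> int) \<Rightarrow> (nat \<Rightarrow> int)" where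
  "signed_perm m d s p x = (\<lambda>i\<in>{..<d}. crep m (s i * x (p i)))"

definition Gd_rel :: "nat \<Rightarrow> nat \<Rightarrow> ((nat \<Rightarrow> int) \<times> (nat \<Rightarrow> int)) set" where
  "Gd_rel m d = {(x, y). x \<in> Zmd m d \<and> y \<in> Zmd m d \<and>
     (\<exists>s p. (\<forall>i<d. s i \<in> {1, -1}) \<and> p permutes {..<d} \<and> y = signed_perm m d s p x)}"

definition orbits :: "nat \<Rightarrow> nat \<Rightarrow> (nat \<Rightarrow> int) set set" where
  "orbits m d = Zmd m d // Gd_rel m d"

definition orbit_of :: "nat \<Rightarrow> nat \<Rightarrow> (nat \<Rightarrow> int) \<Rightarrow> (nat \<Rightarrow> int) set" where
  "orbit_of m d x = Gd_rel m d `` {x}"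

text \<open>The element \<open>(0\<^sup>a, 1\<^sup>b, 2\<^sup>c)\<close> of \<open>\<int>\<^sub>4\<^sup>d\<close>, where \<open>d = a + b + c\<close>.\<close>

definition elem012 :: "nat \<Rightarrow> nat \<Rightarrow> nat \<Rightarrow> (nat \<Rightarrow> int)" where
  "elem012 a b c = (\<lambda>i\<in>{..<a + b + c}. if i < a then 0 else if i < a + b then 1 else 2)"

definition orbit012 :: "nat \<Rightarrow> nat \<Rightarrow> nat \<Rightarrow> (nat \<Rightarrow> int) set" where
  "orbit012 a b c = orbit_of 4 (a + b + c) (elem012 a b c)"


section \<open>The symmetrized discrete Fourier transform\<close>

text \<open>The row orbit enters through an arbitrary representative; \<open>sym_dft_eq\<close> shows that its
  choice is irrelevant.\<close>

definition sym_dft :: "nat \<Rightarrow> nat \<Rightarrow> (nat \<Rightarrow> int) set \<Rightarrow> (nat \<Rightarrow> int) set \<Rightarrow> complex" where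
  "sym_dft m d X Y =
     complex_of_real (real m powr (- real d / 2)) *
     (\<Sum>z\<in>Y. exp (- (2 * of_real pi * \<i> / of_nat m) * of_int (zinner d (SOME x. x \<in> X) z)))"

text \<open>\<open>v = \<F>\<^sup>T u\<close> for real vectors \<open>u\<close>, \<open>v\<close>; the values of \<open>u\<close> and \<open>v\<close> outside
  \<open>orbits m d\<close> play no role.\<close>

definition is_dft_transpose ::
    "nat \<Rightarrow> nat \<Rightarrow> ((nat \<Rightarrow> int) set \<Rightarrow> real) \<Rightarrow> ((nat \<Rightarrow> int) set \<Rightarrow> real) \<Rightarrow> bool" where
  "is_dft_transpose m d u v \<longleftrightarrow>
     (\<forall>Y\<in>orbits m d. complex_of_real (v Y) = (\<Sum>X\<in>orbits m d. sym_dft m d X Y * complex_of_real (u X)))"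


section \<open>Feasible points of the radialized dual linear program\<close>

definition dual_feasible ::
    "real \<Rightarrow> nat \<Rightarrow> nat \<Rightarrow> ((nat \<Rightarrow> int) set \<Rightarrow> real) \<Rightarrow> ((nat \<Rightarrow> int) set \<Rightarrow> real) \<Rightarrow> bool" where
  "dual_feasible r m d \<mu> l \<longleftrightarrow>
     (\<forall>Y\<in>orbits m d. l Y \<ge> 0) \<and>
     is_dft_transpose m d \<mu> l \<and>
     (\<forall>x\<in>Zmd m d. znorm d x \<ge> r \<longrightarrow> \<mu> (orbit_of m d x) \<ge> 0) \<and>
     (\<forall>x\<in>Zmd m d. 0 < znorm d x \<and> znorm d x < r \<longrightarrow> \<mu> (orbit_of m d x) = 0) \<and>
     \<mu> (orbit_of m d (\<lambda>i\<in>{..<d}. 0)) = (r / 2) ^ d"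


section \<open>The explicit dual vector for \<open>m = 4\<close>, \<open>d = 2k + 1\<close>\<close>

definition lam :: "nat \<Rightarrow> (nat \<Rightarrow> int) set \<Rightarrow> real" where
  "lam k Y =
     (if Y = orbit012 (2 * k + 1) 0 0 \<or> Y = orbit012 0 0 (2 * k + 1)
        then 2 ^ (2 * k - 1) / (real k + 1)
      else if Y = orbit012 k 0 (k + 1) \<or> Y = orbit012 (k + 1) 0 k
        then 2 ^ (2 * k - 1) / (real k + 1) * real k
      else if Y = orbit012 k 1 k
        then 2 ^ (2 * k - 1) / (real k + 1) * (2 * real k + 2)
      else 0)"


section \<open>Well-definedness\<close>

lemma mem_centred: "a \<in> centred m \<longleftrightarrow> - int m < 2 * a \<and> 2 * a \<le> int m"
proof -
  have "- int m < 2 * a \<longleftrightarrow> real_of_int (- int m) < real_of_int (2 * a)"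
    by (rule of_int_less_iff[symmetric])
  moreover have "2 * a \<le> int m \<longleftrightarrow> real_of_int (2 * a) \<le> real_of_int (int m)"
    by (rule of_int_le_iff[symmetric])
  ultimately show ?thesis
    unfolding centred_def by auto
qed

lemma centred_inj:
  assumes "a \<in> centred m" "b \<in> centred m" "a mod int m = b mod int m"
  shows "a = b"
proof -
  obtain k where k: "a - b = int m * k"
    using assms(3) by (metis dvdE mod_eq_dvd_iff)
  have "\<bar>a - b\<bar> < int m"
    using assms(1,2) by (auto simp: mem_centred)
  then have "\<bar>k\<bar> < 1"
    by (cases "m = 0") (auto simp: k abs_mult)
  then show ?thesis using k by simp
qed

lemma crep_mod: "crep m a mod int m = a mod int m"
proof -
  have "crep m a mod int m = (int m div 2 - (int m div 2 - a)) mod int m"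
    unfolding crep_def by (rule mod_diff_right_eq)
  then show ?thesis by (simp only: diff_diff_eq2 add_diff_cancel_left')
qed

lemma crep_centred:
  assumes "m > 0"
  shows "crep m a \<in> centred m"
proof -
  have *: "- M < 2 * (q - t) \<and> 2 * (q - t) \<le> M"
    if "0 \<le> t" "t < M" "M - 1 \<le> 2 * q" "2 * q \<le> M" for M q t :: int
    using that by simp
  have "int m - 1 \<le> 2 * (int m div 2)" "2 * (int m div 2) \<le> int m"
    by presburger+
  then show ?thesis
    unfolding mem_centred crep_def using assms by (intro *) simp_all
qed

lemma crep_eq_iff:
  assumes "m > 0"
  shows "crep m a = b \<longleftrightarrow> b \<in> centred m \<and> b mod int m = a mod int m"
proof
  assume "crep m a = b"
  then show "b \<in> centred m \<and> b mod int m = a mod int m"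
    using crep_centred[OF assms, of a] crep_mod[of m a] by blast
next
  assume b: "b \<in> centred m \<and> b mod int m = a mod int m"
  show "crep m a = b"
  proof (rule centred_inj)
    show "crep m a mod int m = b mod int m" by (rule trans[OF crep_mod conjunct2[OF b, symmetric]])
  qed (use crep_centred[OF assms] b in blast)+
qed

lemma finite_Zmd: "finite (Zmd m d)"
proof -
  have "centred m \<subseteq> {- int m..int m}" by (auto simp: mem_centred)
  then have "finite (centred m)" by (rule finite_subset) simp
  then show ?thesis unfolding Zmd_def by (intro finite_PiE) auto
qed

lemma signed_perm_Zmd: "m > 0 \<Longrightarrow> signed_perm m d s p x \<in> Zmd m d"
  unfolding signed_perm_def Zmd_def by (auto simp: crep_centred)

lemma Gd_relI:
  assumes "m > 0" "x \<in> Zmd m d" "\<And>i. i < d \<Longrightarrow> s i \<in> {1, -1}" "p permutes {..<d}"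
    "y = signed_perm m d s p x"
  shows "(x, y) \<in> Gd_rel m d"
proof -
  have "y \<in> Zmd m d" unfolding assms(5) by (rule signed_perm_Zmd[OF assms(1)])
  moreover have "\<exists>s p. (\<forall>i<d. s i \<in> {1, -1}) \<and> p permutes {..<d} \<and> y = signed_perm m d s p x"
    using assms(3-5) by (intro exI[of _ s] exI[of _ p] conjI) simp_all
  ultimately show ?thesis
    using assms(2) unfolding Gd_rel_def by simp
qed

lemma Zmd_eqI:
  assumes "x \<in> Zmd m d" "y \<in> Zmd m d" "\<And>i. i < d \<Longrightarrow> x i mod int m = y i mod int m"
  shows "x = y"
proof (rule PiE_ext[OF assms(1,2)[unfolded Zmd_def]])
  fix i assume "i \<in> {..<d}"
  then have "i < d" "x i \<in> centred m" "y i \<in> centred m"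
    using assms(1,2) by (auto simp: Zmd_def)
  then show "x i = y i"
    using centred_inj assms(3) by blast
qed

lemma signed_perm_mod:
  "i < d \<Longrightarrow> signed_perm m d s p x i mod int m = s i * x (p i) mod int m"
  by (simp add: signed_perm_def crep_mod)

lemma permutes_lessThan_lt: "p permutes {..<d} \<Longrightarrow> i < d \<Longrightarrow> p i < (d::nat)"
  using permutes_in_image[of p "{..<d}" i] by simp

lemma equiv_Gd_rel:
  assumes m: "m > 0"
  shows "equiv (Zmd m d) (Gd_rel m d)"
proof (rule equivI)
  show "Gd_rel m d \<subseteq> Zmd m d \<times> Zmd m d" by (auto simp: Gd_rel_def)
  show "refl_on (Zmd m d) (Gd_rel m d)"
  proof (rule refl_onI)
    fix x assume x: "x \<in> Zmd m d"
    have "x = signed_perm m d (\<lambda>_. 1) id x"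
      by (rule Zmd_eqI[OF x signed_perm_Zmd[OF m]]) (simp add: signed_perm_mod)
    then show "(x, x) \<in> Gd_rel m d"
      by (intro Gd_relI[OF m x _ permutes_id]) simp_all
  qed
  show "sym (Gd_rel m d)"
  proof (rule symI)
    fix x y assume "(x, y) \<in> Gd_rel m d"
    then obtain s p where x: "x \<in> Zmd m d" and s: "\<forall>i<d. s i \<in> {1, -1}" and p: "p permutes {..<d}"
      and y: "y = signed_perm m d s p x" by (auto simp: Gd_rel_def)
    let ?q = "inv p" and ?t = "\<lambda>i. s (inv p i)"
    have q: "?q permutes {..<d}" by (rule permutes_inv[OF p])
    have "x = signed_perm m d ?t ?q y"
    proof (rule Zmd_eqI[OF x signed_perm_Zmd[OF m]])
      fix i assume i: "i < d"
      have qi: "?q i < d" by (rule permutes_lessThan_lt[OF q i])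
      have "signed_perm m d ?t ?q y i mod int m = s (?q i) * y (?q i) mod int m"
        by (rule signed_perm_mod[OF i])
      also have "\<dots> = s (?q i) * (s (?q i) * x (p (?q i))) mod int m"
        using signed_perm_mod[OF qi, of m s p x] unfolding y by (metis mod_mult_right_eq)
      also have "\<dots> = x i mod int m"
        using s qi permutes_inverses(1)[OF p, of i] by auto
      finally show "x i mod int m = signed_perm m d ?t ?q y i mod int m" ..
    qed
    moreover have "?t i \<in> {1, -1}" if "i < d" for i
      using s permutes_lessThan_lt[OF q that] by blast
    moreover have "y \<in> Zmd m d" unfolding y by (rule signed_perm_Zmd[OF m])
    ultimately show "(y, x) \<in> Gd_rel m d"
      using Gd_relI[OF m _ _ q, of y ?t x] by blast
  qed
  show "trans (Gd_rel m d)"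
  proof (rule transI)
    fix x y z assume "(x, y) \<in> Gd_rel m d" "(y, z) \<in> Gd_rel m d"
    then obtain s p t q where x: "x \<in> Zmd m d" and s: "\<forall>i<d. s i \<in> {1, -1}" and p: "p permutes {..<d}"
      and y: "y = signed_perm m d s p x" and t: "\<forall>i<d. t i \<in> {1, -1}" and q: "q permutes {..<d}"
      and z: "z \<in> Zmd m d" "z = signed_perm m d t q y" by (auto simp: Gd_rel_def)
    let ?u = "\<lambda>i. t i * s (q i)"
    have "z = signed_perm m d ?u (p \<circ> q) x"
    proof (rule Zmd_eqI[OF z(1) signed_perm_Zmd[OF m]])
      fix i assume i: "i < d"
      have qi: "q i < d" by (rule permutes_lessThan_lt[OF q i])
      have "z i mod int m = t i * y (q i) mod int m"
        unfolding z(2) by (rule signed_perm_mod[OF i])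
      also have "\<dots> = t i * (s (q i) * x (p (q i))) mod int m"
        using signed_perm_mod[OF qi, of m s p x] unfolding y by (metis mod_mult_right_eq)
      finally show "z i mod int m = signed_perm m d ?u (p \<circ> q) x i mod int m"
        by (simp add: signed_perm_mod[OF i] mult.assoc)
    qed
    moreover have "?u i \<in> {1, -1}" if "i < d" for i
    proof -
      have "s (q i) = 1 \<or> s (q i) = -1" "t i = 1 \<or> t i = -1"
        using s t permutes_lessThan_lt[OF q that] that by blast+
      then show ?thesis by auto
    qed
    ultimately show "(x, z) \<in> Gd_rel m d"
      using Gd_relI[OF m x _ permutes_compose[OF q p], of ?u z] by blast
  qed
qed

lemma exp_zinner_cong:
  assumes m: "m > 0" and ab: "a mod int m = b mod int m"
  shows "exp (- (2 * of_real pi * \<i> / of_nat m) * of_int a) =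
         (exp (- (2 * of_real pi * \<i> / of_nat m) * of_int b) :: complex)"
proof -
  obtain k where k: "a = b + int m * k"
    using ab by (metis add.commute diff_add_cancel dvdE mod_eq_dvd_iff)
  have "- (2 * of_real pi * \<i> / of_nat m) * of_int a =
        - (2 * of_real pi * \<i> / of_nat m) * of_int b + (of_int (2 * (- k)) * pi) * \<i>"
    using m unfolding k by (simp add: field_simps)
  then show ?thesis
    unfolding exp_eq by blast
qed

lemma zinner_signed_perm:
  assumes s: "\<forall>i<d. s i \<in> {1, -1}" and p: "p permutes {..<d}"
  shows "zinner d (signed_perm m d s p x) (signed_perm m d s p z) mod int m = zinner d x z mod int m"
proof -
  have "zinner d (signed_perm m d s p x) (signed_perm m d s p z) mod int m
      = (\<Sum>i<d. (s i * x (p i)) * (s i * z (p i))) mod int m"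
  proof -
    have "signed_perm m d s p x i * signed_perm m d s p z i mod int m =
        (s i * x (p i)) * (s i * z (p i)) mod int m" if "i < d" for i
      by (rule mod_mult_cong[OF signed_perm_mod[OF that] signed_perm_mod[OF that]])
    then have *: "(\<Sum>i<d. signed_perm m d s p x i * signed_perm m d s p z i mod int m) =
        (\<Sum>i<d. (s i * x (p i)) * (s i * z (p i)) mod int m)"
      by (intro sum.cong refl) simp
    from arg_cong[OF *, of "\<lambda>t. t mod int m"] show ?thesis
      unfolding zinner_def by (simp only: mod_sum_eq)
  qed
  also have "(\<Sum>i<d. (s i * x (p i)) * (s i * z (p i))) = (\<Sum>i<d. x (p i) * z (p i))"
    using s by (intro sum.cong) auto
  also have "\<dots> = zinner d x z"
    unfolding zinner_def using sum.permute[OF p, of "\<lambda>i. x i * z i"] by (simp add: comp_def)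
  finally show ?thesis .
qed

lemma sym_dft_eq:
  assumes m: "m > 0" and X: "X \<in> orbits m d" and Y: "Y \<in> orbits m d" and x: "x \<in> X"
  shows "sym_dft m d X Y = complex_of_real (real m powr (- real d / 2)) *
    (\<Sum>z\<in>Y. exp (- (2 * of_real pi * \<i> / of_nat m) * of_int (zinner d x z)))"
proof -
  let ?e = "\<lambda>x z. exp (- (2 * of_real pi * \<i> / of_nat m) * of_int (zinner d x z)) :: complex"
  define x' where "x' = (SOME x. x \<in> X)"
  have x': "x' \<in> X" unfolding x'_def by (rule someI[of "\<lambda>x. x \<in> X", OF x])
  have eq: "equiv (Zmd m d) (Gd_rel m d)" by (rule equiv_Gd_rel[OF m])
  have "(x, x') \<in> Gd_rel m d"
    using in_quotient_imp_in_rel[OF eq X[unfolded orbits_def]] x x' by simp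
  then obtain s p where s: "\<forall>i<d. s i \<in> {1, -1}" and p: "p permutes {..<d}"
    and x'_eq: "x' = signed_perm m d s p x" by (auto simp: Gd_rel_def)
  let ?g = "signed_perm m d s p"
  have YZ: "Y \<subseteq> Zmd m d"
    by (rule in_quotient_imp_subset[OF eq Y[unfolded orbits_def]])
  have "inj_on ?g Y"
  proof (rule inj_onI)
    fix z w assume zw: "z \<in> Y" "w \<in> Y" "?g z = ?g w"
    show "z = w"
    proof (rule Zmd_eqI)
      show "z \<in> Zmd m d" "w \<in> Zmd m d" using zw YZ by auto
      fix i assume i: "i < d"
      define j where "j = inv p i"
      have j: "j < d" unfolding j_def by (rule permutes_lessThan_lt[OF permutes_inv[OF p] i])
      have pj: "p j = i" unfolding j_def by (rule permutes_inverses(1)[OF p])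
      have "s j * z i mod int m = s j * w i mod int m"
        using signed_perm_mod[OF j, of m s p z] signed_perm_mod[OF j, of m s p w] zw(3) pj by simp
      then have "s j * (s j * z i) mod int m = s j * (s j * w i) mod int m"
        by (metis mod_mult_right_eq)
      then show "z i mod int m = w i mod int m" using s j by auto
    qed
  qed
  moreover have "?g ` Y \<subseteq> Y"
  proof
    fix w assume "w \<in> ?g ` Y"
    then obtain z where z: "z \<in> Y" "w = ?g z" by blast
    have "(z, w) \<in> Gd_rel m d"
    proof (rule Gd_relI[OF m _ _ p z(2)])
      show "z \<in> Zmd m d" using z(1) YZ by blast
      show "s i \<in> {1, -1}" if "i < d" for i using s that by blast
    qed
    then show "w \<in> Y"
      by (rule in_quotient_imp_closed[OF eq Y[unfolded orbits_def] z(1)])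
  qed
  moreover have "finite Y" by (rule finite_subset[OF YZ finite_Zmd])
  ultimately have bij: "bij_betw ?g Y Y"
    by (simp add: bij_betw_def endo_inj_surj)
  have "(\<Sum>z\<in>Y. ?e x' z) = (\<Sum>z\<in>Y. ?e x' (?g z))"
    by (rule sum.reindex_bij_betw[OF bij, symmetric])
  also have "\<dots> = (\<Sum>z\<in>Y. ?e x z)"
    unfolding x'_eq by (intro sum.cong refl exp_zinner_cong[OF m] zinner_signed_perm[OF s p])
  finally show ?thesis
    unfolding sym_dft_def x'_def by simp
qed

text \<open>Distinct triples give distinct orbits, so the cases in \<open>lam\<close> do not overlap.\<close>

lemma orbit012_eq_iff:
  assumes "a + b + c = a' + b' + c'"
  shows "orbit012 a b c = orbit012 a' b' c' \<longleftrightarrow> a = a' \<and> b = b' \<and> c = c'"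
proof
  assume eq: "orbit012 a b c = orbit012 a' b' c'"
  define d where "d = a + b + c"
  have d': "a' + b' + c' = d" using assms d_def by simp
  have mem: "elem012 a b c \<in> Zmd 4 (a + b + c)" for a b c
    by (auto simp: elem012_def Zmd_def mem_centred)
  have card: "card {i\<in>{..<a + b + c}. elem012 a b c i = 0} = a"
    "card {i\<in>{..<a + b + c}. elem012 a b c i = 2} = c" for a b c
  proof -
    have "{i\<in>{..<a + b + c}. elem012 a b c i = 0} = {..<a}"
      "{i\<in>{..<a + b + c}. elem012 a b c i = 2} = {a + b..<a + b + c}"
      by (auto simp: elem012_def split: if_splits)
    then show "card {i\<in>{..<a + b + c}. elem012 a b c i = 0} = a"
      "card {i\<in>{..<a + b + c}. elem012 a b c i = 2} = c" by simp_all
  qed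
  let ?x = "elem012 a b c" and ?y = "elem012 a' b' c'"
  have "(?x, ?y) \<in> Gd_rel 4 d"
    using eq mem[of a b c] mem[of a' b' c'] eq_equiv_class_iff[OF equiv_Gd_rel[of 4 d]] d'
    unfolding orbit012_def orbit_of_def d_def[symmetric] by auto
  then obtain s p where s: "\<forall>i<d. s i \<in> {1, -1}" and p: "p permutes {..<d}"
    and y: "?y = signed_perm 4 d s p ?x" by (auto simp: Gd_rel_def)
  have val: "?y i = v \<longleftrightarrow> ?x (p i) = v" if "i < d" and v: "v = 0 \<or> v = 2" for i v
  proof -
    have pi: "p i < d" by (rule permutes_lessThan_lt[OF p \<open>i < d\<close>])
    have "?x (p i) \<in> {0, 1, 2}" using pi by (auto simp: elem012_def d_def)
    moreover have "?y i = crep 4 (s i * ?x (p i))"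
      using that by (simp add: y signed_perm_def)
    moreover have "s i = 1 \<or> s i = -1" using s that by auto
    ultimately show ?thesis using v by (auto simp: crep_def)
  qed
  have "card {i\<in>{..<d}. ?y i = v} = card {i\<in>{..<d}. ?x i = v}" if "v = 0 \<or> v = 2" for v
  proof -
    have "bij_betw p {i\<in>{..<d}. ?y i = v} {i\<in>{..<d}. ?x i = v}"
      unfolding bij_betw_def
    proof
      show "inj_on p {i\<in>{..<d}. ?y i = v}" using permutes_inj_on[OF p] .
      show "p ` {i\<in>{..<d}. ?y i = v} = {i\<in>{..<d}. ?x i = v}"
      proof (intro equalityI subsetI)
        fix j assume "j \<in> p ` {i\<in>{..<d}. ?y i = v}"
        then show "j \<in> {i\<in>{..<d}. ?x i = v}"
          using val[OF _ that] permutes_lessThan_lt[OF p] by auto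
      next
        fix j assume j: "j \<in> {i\<in>{..<d}. ?x i = v}"
        have "inv p j < d" using j permutes_lessThan_lt[OF permutes_inv[OF p]] by simp
        moreover have "p (inv p j) = j" by (rule permutes_inverses(1)[OF p])
        ultimately show "j \<in> p ` {i\<in>{..<d}. ?y i = v}"
          using j val[OF _ that, of "inv p j"] by (intro image_eqI[of _ _ "inv p j"]) auto
      qed
    qed
    then show ?thesis by (rule bij_betw_same_card)
  qed
  from this[of 0] this[of 2] have "a = a'" "c = c'"
    using card[of a b c] card[of a' b' c'] unfolding d' d_def[symmetric] by simp_all
  then show "a = a' \<and> b = b' \<and> c = c'" using assms by simp
qed simp

end

theory Submission
  imports Defs "HOL-Computational_Algebra.Polynomial"
begin

text \<open>
  Write \<open>d = 2k + 1\<close> and spread each value \<open>\<lambda>\<^sub>X\<close> evenly over its orbit \<open>X\<close>. Swapping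
  the two orbits in the symmetrized transform (\<open>sym_dft_card_swap\<close>) shows that \<open>\<mu>\<^sub>Y\<close> is, up to
  the factor \<open>4\<^bsup>-d/2\<^esup> |Y|\<close>, the ordinary Fourier transform of this spread-out function at
  any \<open>y \<in> Y\<close>. So everything is decided by one number, which depends only on how many entries
  \<open>0\<close>, \<open>\<plusminus>1\<close> and \<open>2\<close> the vector \<open>y\<close> has; call these counts \<open>a\<close>, \<open>b\<close> and \<open>c\<close>.

  The orbits that carry \<open>\<lambda>\<close> consist of vectors with at most one odd entry, so their
  character sums reduce to sums of \<open>(-1)\<^bsup>|S \<inter> B|\<^esup>\<close> over subsets \<open>S\<close> of fixed size, with
  \<open>B\<close> the set of odd places of \<open>y\<close>. These are Krawtchouk numbers. Their
  symmetry (\<open>krawtchouk_swap\<close>) moves the size \<open>k\<close> or \<open>k + 1\<close> of \<open>S\<close> into the exponents of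
  \<open>(1 - t)\<close> and \<open>(1 + t)\<close>, which are then equal or differ by one; the generating
  function collapses to \<open>(1 - t\<^sup>2)\<^sup>k\<close>, possibly times \<open>1 \<plusminus> t\<close>, and every term has a closed
  form.

  The outcome is that the transform vanishes when \<open>b\<close> is odd (\<open>lam_hat_odd\<close>), and for \<open>b = 2j\<close>
  it is a positive multiple of
  \<open>1 + (-1)\<^sup>j (k choose j) / (d choose 2j) * (k + (k + 1) (a - c) / (a + c))\<close>
  (\<open>lam_hat_even\<close>). Since \<open>k + (k + 1) (a - c) / (a + c)\<close> lies between \<open>-1\<close> and \<open>d\<close>,
  this is nonnegative for even \<open>j\<close> because the quotient of binomials is at most \<open>1\<close>, and for odd
  \<open>j\<close> because it is at most \<open>1 / d\<close> (\<open>double_binomial_le\<close>).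
  The nonzero vectors of norm below \<open>2\<close> have no entry \<open>2\<close> and one, two or three odd entries:
  the parity handles one and three, and for two odd entries the bound just mentioned is attained
  (\<open>lam_hat_two\<close>). The value at the origin is a direct evaluation.

  Finally, \<open>\<lambda> = \<F>\<^sup>T \<mu>\<close> follows from \<open>\<mu> = \<F>\<^sup>T \<lambda>\<close> because the symmetrized transform is an
  involution (\<open>sym_dft_involutive\<close>).
\<close>

section \<open>Krawtchouk numbers\<close>

text \<open>The value at \<open>b\<close> of the binary Krawtchouk polynomial of degree \<open>s\<close> for length \<open>n\<close>, given by its
  generating function. The truncated difference makes the values for \<open>b > n\<close> meaningless.\<close>

definition krawtchouk :: "nat \<Rightarrow> nat \<Rightarrow> nat \<Rightarrow> real" where
  "krawtchouk n s b = coeff ([:1, -1:] ^ b * [:1, 1:] ^ (n - b)) s"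

text \<open>Expanding \<open>\<Prod>\<^sub>i (1 + \<epsilon>\<^sub>i t)\<close>, with \<open>\<epsilon>\<^sub>i = -1\<close> exactly for \<open>i \<in> B\<close>, gives one term for each
  \<open>S\<close>, of degree \<open>|S|\<close> and with sign \<open>(-1)\<^bsup>|S \<inter> B|\<^esup>\<close>.\<close>

lemma sum_subsets_eq_krawtchouk:
  assumes A: "finite A" and B: "B \<subseteq> A"
  shows "(\<Sum>S | S \<subseteq> A \<and> card S = s. (-1) ^ card (S \<inter> B)) = krawtchouk (card A) s (card B)"
proof -
  define eps :: "'a \<Rightarrow> real" where "eps i = (if i \<in> B then -1 else 1)" for i
  have prod_eps: "prod eps S = (-1) ^ card (S \<inter> B)" if "S \<subseteq> A" for S
  proof -
    have "finite S" using that A finite_subset by blast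
    then have "prod eps S = (\<Prod>i\<in>S \<inter> B. -1)"
      by (subst prod.inter_restrict) (auto simp: eps_def)
    then show ?thesis by simp
  qed
  have "[:1, -1:] ^ card B * [:1, 1:] ^ (card A - card B) = (\<Prod>i\<in>A. [:1, eps i:])"
  proof -
    have "(\<Prod>i\<in>A. [:1, eps i:]) = (\<Prod>i\<in>A - B. [:1, eps i:]) * (\<Prod>i\<in>B. [:1, eps i:])"
      by (rule prod.subset_diff[OF B A])
    also have "(\<Prod>i\<in>A - B. [:1, eps i:]) = [:1, 1:] ^ card (A - B)"
      by (simp add: eps_def)
    also have "(\<Prod>i\<in>B. [:1, eps i:]) = [:1, -1:] ^ card B"
      by (simp add: eps_def)
    finally show ?thesis
      using card_Diff_subset[OF finite_subset[OF B A] B] by (simp add: mult.commute)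
  qed
  also have "\<dots> = (\<Prod>i\<in>A. monom (eps i) 1 + 1)"
    by (intro prod.cong) (simp_all add: monom_altdef one_pCons)
  also have "\<dots> = (\<Sum>S\<in>Pow A. monom (prod eps S) (card S))"
  proof -
    have "(\<Prod>i\<in>S. monom (eps i) 1) = monom (prod eps S) (card S)" if "S \<in> Pow A" for S
    proof -
      have "finite S" using that A finite_subset by blast
      then show ?thesis by (induction S) (simp_all add: mult_monom)
    qed
    then show ?thesis by (simp add: prod_add[OF A])
  qed
  finally have "krawtchouk (card A) s (card B) = (\<Sum>S\<in>Pow A. if card S = s then prod eps S else 0)"
    by (simp add: krawtchouk_def coeff_sum)
  also have "\<dots> = (\<Sum>S\<in>Pow A \<inter> {S. card S = s}. prod eps S)"
    using A by (simp add: sum.inter_restrict)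
  also have "\<dots> = (\<Sum>S | S \<subseteq> A \<and> card S = s. (-1) ^ card (S \<inter> B))"
    by (intro sum.cong) (auto simp: prod_eps)
  finally show ?thesis by simp
qed

text \<open>Both sides count the pairs \<open>(S, B)\<close> of subsets of sizes \<open>s\<close> and \<open>b\<close> with the sign
  \<open>(-1)\<^bsup>|S \<inter> B|\<^esup>\<close>, which is symmetric in \<open>S\<close> and \<open>B\<close>.\<close>

lemma krawtchouk_swap:
  assumes "s \<le> n" "b \<le> n"
  shows "real (n choose b) * krawtchouk n s b = real (n choose s) * krawtchouk n b s"
proof -
  let ?P = "\<lambda>c. {S. S \<subseteq> {..<n} \<and> card S = c}"
  have card: "card (?P c) = n choose c" for c
    using n_subsets[of "{..<n}" c] by simp
  have row: "(\<Sum>S\<in>?P s. (-1) ^ card (S \<inter> B)) = krawtchouk n s b" if "B \<in> ?P b" for B s b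
    using sum_subsets_eq_krawtchouk[of "{..<n}" B s] that by simp
  have "real (n choose b) * krawtchouk n s b = (\<Sum>B\<in>?P b. \<Sum>S\<in>?P s. (-1) ^ card (S \<inter> B))"
    using card[of b] by (simp add: row)
  also have "\<dots> = (\<Sum>S\<in>?P s. \<Sum>B\<in>?P b. (-1) ^ card (B \<inter> S))"
    by (subst sum.swap) (simp add: Int_commute)
  also have "\<dots> = real (n choose s) * krawtchouk n b s"
    using card[of s] by (simp add: row)
  finally show ?thesis .
qed

lemma coeff_one_minus_square_power:
  "coeff ([:1, 0, -1:] ^ k) n =
     (if even n then (-1) ^ (n div 2) * real (k choose (n div 2)) else 0)"
proof -
  have mono: "monom (-1 :: real) 2 ^ i = monom ((-1) ^ i) (2 * i)" for i
    by (simp add: monom_power mult.commute)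
  have "[:1, 0, -1:] = monom (-1 :: real) 2 + 1"
    by (simp add: monom_altdef one_pCons numeral_2_eq_2)
  then have "[:1, 0, -1:] ^ k = (\<Sum>i\<le>k. of_nat (k choose i) * monom ((-1) ^ i) (2 * i) :: real poly)"
    by (simp add: binomial_ring mono)
  then have "coeff ([:1, 0, -1:] ^ k) n
      = (\<Sum>i\<le>k. if n = 2 * i then real (k choose i) * (-1) ^ i else 0)"
    by (auto simp: coeff_sum of_nat_poly intro!: sum.cong)
  also have "\<dots> = (if even n then (-1) ^ (n div 2) * real (k choose (n div 2)) else 0)"
  proof (cases "even n")
    case True
    then have "(n = 2 * i) = (n div 2 = i)" for i by auto
    then show ?thesis using True by (simp add: binomial_eq_0)
  next
    case False
    then have "(n = 2 * i) = False" for i by auto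
    then show ?thesis using False by simp
  qed
  finally show ?thesis .
qed

lemma one_minus_square_power: "[:1, -1:] ^ k * [:1, 1:] ^ k = ([:1, 0, -1:] ^ k :: real poly)"
  by (simp flip: power_mult_distrib)

lemma krawtchouk_middle_even:
  "krawtchouk (2 * k) b k = (if even b then (-1) ^ (b div 2) * real (k choose (b div 2)) else 0)"
  by (simp add: krawtchouk_def mult_2 one_minus_square_power coeff_one_minus_square_power)

text \<open>Here the exponents of \<open>1 - t\<close> and \<open>1 + t\<close> differ by one, so the generating function is
  \<open>(1 \<plusminus> t) (1 - t\<^sup>2)\<^sup>k\<close>: two consecutive coefficients agree up to the sign of \<open>t\<close>.\<close>

lemma krawtchouk_middle_odd:
  "krawtchouk (2 * k + 1) (2 * j) k = (-1) ^ j * real (k choose j)"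
  "krawtchouk (2 * k + 1) (2 * j) (k + 1) = (-1) ^ j * real (k choose j)"
  "krawtchouk (2 * k + 1) (2 * j + 1) k = (-1) ^ j * real (k choose j)"
  "krawtchouk (2 * k + 1) (2 * j + 1) (k + 1) = - ((-1) ^ j * real (k choose j))"
proof -
  have eq: "krawtchouk (2 * k + 1) b k = coeff ([:1, 1:] * [:1, 0, -1:] ^ k) b"
    "krawtchouk (2 * k + 1) b (k + 1) = coeff ([:1, -1:] * [:1, 0, -1:] ^ k) b" for b
    by (simp_all add: krawtchouk_def Suc_diff_le one_minus_square_power algebra_simps
        flip: one_minus_square_power)
  have shift: "coeff (pCons 0 ([:1, 0, -1:] ^ k)) (2 * j) = (0 :: real)"
    "coeff (pCons 0 (- ([:1, 0, -1:] ^ k))) (2 * j) = (0 :: real)"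
    by (cases j; simp add: coeff_one_minus_square_power)+
  show "krawtchouk (2 * k + 1) (2 * j) k = (-1) ^ j * real (k choose j)"
    "krawtchouk (2 * k + 1) (2 * j) (k + 1) = (-1) ^ j * real (k choose j)"
    "krawtchouk (2 * k + 1) (2 * j + 1) k = (-1) ^ j * real (k choose j)"
    "krawtchouk (2 * k + 1) (2 * j + 1) (k + 1) = - ((-1) ^ j * real (k choose j))"
    unfolding eq using shift by (simp_all add: coeff_one_minus_square_power)
qed

lemma krawtchouk_top: "b \<le> n \<Longrightarrow> krawtchouk n n b = (-1) ^ b"
  using krawtchouk_swap[of n n b] by (simp add: krawtchouk_def coeff_linear_poly_power)

lemma krawtchouk_0_right: "s \<le> n \<Longrightarrow> krawtchouk n s 0 = real (n choose s)"
  by (simp add: krawtchouk_def coeff_linear_poly_power)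

lemma krawtchouk_0_left: "b \<le> n \<Longrightarrow> krawtchouk n 0 b = 1"
  using krawtchouk_swap[of 0 n b] by (simp add: krawtchouk_0_right)

section \<open>Doubling both arguments of a binomial coefficient\<close>

text \<open>In terms of double factorials this is \<open>(2p+1)!! (2q+1)!! \<le> (2p+2q+1)!!\<close>, since
  the quotient of the two binomial coefficients is \<open>(2p+2q+3)!! / ((2p+1)!! (2q+1)!!)\<close>. Passing from
  \<open>q\<close> to \<open>q + 1\<close> gives the left side the factor \<open>2q + 3\<close> and the right side the larger factor
  \<open>2p + 2q + 3\<close>.\<close>

lemma odd_double_binomial_le:
  "(2 * p + 2 * q + 3) * ((p + q + 1) choose (p + 1)) \<le> (2 * p + 2 * q + 3) choose (2 * p + 2)"
proof (induction q)
  case 0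
  have "(2 * p + 3) choose (2 * p + 2) = 2 * p + 3"
    using binomial_symmetric[of "2 * p + 2" "2 * p + 3"] by simp
  then show ?case by simp
next
  case (Suc q)
  let ?n = "2 * p + 2 * q + 3"
  have step: "(a choose b) * (a + 1) = ((a + 1) choose b) * (a + 1 - b)" for a b :: nat
    using binomial_absorb_comp[of "a + 1" b] by (simp add: mult.commute)
  have small: "((p + q + 1) choose (p + 1)) * (p + q + 2) = ((p + q + 2) choose (p + 1)) * (q + 1)"
    using step[of "p + q + 1" "p + 1"] by simp
  have big1: "(?n choose (2 * p + 2)) * (?n + 1) = ((?n + 1) choose (2 * p + 2)) * (2 * q + 2)"
    using step[of ?n "2 * p + 2"] by simp
  have big2: "((?n + 1) choose (2 * p + 2)) * (?n + 2) = ((?n + 2) choose (2 * p + 2)) * (2 * q + 3)"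
    using step[of "?n + 1" "2 * p + 2"] by simp
  let ?a = "(p + q + 1) choose (p + 1)" and ?a' = "(p + q + 2) choose (p + 1)"
    and ?b = "?n choose (2 * p + 2)" and ?b' = "(?n + 1) choose (2 * p + 2)" and ?b'' = "(?n + 2) choose (2 * p + 2)"
  have "(?n + 2) * ?a' * ((2 * q + 3) * (q + 1)) = (?n + 2) * ((2 * q + 3) * (?a' * (q + 1)))"
    by (simp only: ac_simps)
  also have "\<dots> = (?n + 2) * ((2 * q + 3) * (?a * (p + q + 2)))"
    unfolding small ..
  also have "\<dots> \<le> (?n + 2) * (?n * (?a * (p + q + 2)))"
    by (intro mult_le_mono) auto
  also have "\<dots> = (?n + 2) * ((p + q + 2) * (?n * ?a))" by (simp only: ac_simps)
  also have "\<dots> \<le> (?n + 2) * ((p + q + 2) * ?b)"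
    using Suc.IH by (intro mult_le_mono) auto
  also have "\<dots> = ?b'' * ((2 * q + 3) * (q + 1))"
  proof -
    have "(p + q + 2) * ?b = ?b' * (q + 1)" using big1 by (simp add: algebra_simps)
    then have "(?n + 2) * ((p + q + 2) * ?b) = (?b' * (?n + 2)) * (q + 1)" by (simp only: ac_simps)
    then show ?thesis unfolding big2 by (simp only: ac_simps)
  qed
  finally have "(?n + 2) * ?a' \<le> ?b''" by (simp only: mult_le_cancel2) simp
  then show ?case by (simp add: algebra_simps)
qed

lemma double_binomial_le:
  assumes "1 \<le> j" "j \<le> k"
  shows "(2 * k + 1) * (k choose j) \<le> (2 * k + 1) choose (2 * j)"
proof -
  obtain p where p: "j = p + 1" using assms(1) by (metis add.commute le_Suc_ex)
  obtain q where "k = j + q" using le_Suc_ex[OF assms(2)] by blast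
  then have q: "k = p + q + 1" using p by simp
  have "2 * k + 1 = 2 * p + 2 * q + 3" "2 * j = 2 * p + 2" using p q by simp_all
  then show ?thesis using odd_double_binomial_le[of p q] unfolding p q by metis
qed

lemma binomial_le_double: "k choose j \<le> (2 * k + 1) choose (2 * j)"
proof (cases "1 \<le> j \<and> j \<le> k")
  case True
  then have "(2 * k + 1) * (k choose j) \<le> (2 * k + 1) choose (2 * j)"
    by (intro double_binomial_le) auto
  moreover have "1 * (k choose j) \<le> (2 * k + 1) * (k choose j)" by (intro mult_le_mono) auto
  ultimately show ?thesis by linarith
next
  case False
  then show ?thesis by (cases "j = 0") (auto simp: binomial_eq_0)
qed

section \<open>The symmetrized transform is an involution\<close>

text \<open>The characters of \<open>\<int>\<^sub>m\<close>, in exactly the form in which the symmetrized transform uses them.\<close>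

definition zchar :: "nat \<Rightarrow> int \<Rightarrow> complex" where
  "zchar m t = exp (- (2 * of_real pi * \<i> / of_nat m) * of_int t)"

lemma zchar_0 [simp]: "zchar m 0 = 1"
  by (simp add: zchar_def)

lemma zchar_add: "zchar m (a + b) = zchar m a * zchar m b"
  by (simp only: zchar_def of_int_add distrib_left exp_add)

lemma zchar_sum: "zchar m (sum f A) = (\<Prod>i\<in>A. zchar m (f i))"
  by (induction A rule: infinite_finite_induct) (simp_all add: zchar_add)

lemma zchar_cong: "m > 0 \<Longrightarrow> a mod int m = b mod int m \<Longrightarrow> zchar m a = zchar m b"
  unfolding zchar_def by (rule exp_zinner_cong)

lemma zchar_eq_1_iff:
  assumes m: "m > 0"
  shows "zchar m t = 1 \<longleftrightarrow> int m dvd t"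
proof
  assume "zchar m t = 1"
  then obtain n :: int where "- (2 * pi * of_int t / of_nat m) = of_int (2 * n) * pi"
    by (auto simp: zchar_def exp_eq_1)
  then have "pi * real_of_int t = pi * of_int (int m * - n)"
    using m by (simp add: field_simps)
  then have "real_of_int t = of_int (int m * - n)"
    by (simp only: mult_cancel_left) simp
  then have "t = int m * - n" by (simp only: of_int_eq_iff)
  then show "int m dvd t" by simp
next
  assume "int m dvd t"
  then show "zchar m t = 1" using zchar_cong[OF m, of t 0] by simp
qed

lemma card_centred: "card (centred m) = m"
proof -
  have "centred m = {int m div 2 - int m + 1..int m div 2}"
    by (auto simp: mem_centred)
  then show ?thesis by simp
qed

lemma finite_centred: "finite (centred m)"
  by (rule finite_subset[of _ "{- int m..int m}"]) (auto simp: mem_centred)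

text \<open>Shifting the summation variable by one permutes the representatives and multiplies the sum by
  \<open>zchar m w\<close>; so the sum vanishes unless this factor is \<open>1\<close>.\<close>

lemma sum_zchar_centred:
  assumes m: "m > 0"
  shows "(\<Sum>a\<in>centred m. zchar m (a * w)) = (if int m dvd w then of_nat m else 0)"
proof (cases "int m dvd w")
  case True
  then have "zchar m (a * w) = 1" for a
    using zchar_eq_1_iff[OF m] by simp
  then show ?thesis using True by (simp add: card_centred)
next
  case False
  let ?f = "\<lambda>a. crep m (a + 1)"
  let ?S = "\<Sum>a\<in>centred m. zchar m (a * w)"
  have "inj_on ?f (centred m)"
  proof (rule inj_onI)
    fix a b assume ab: "a \<in> centred m" "b \<in> centred m" "?f a = ?f b"
    then have "(a + 1) mod int m = (b + 1) mod int m"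
      using crep_mod by metis
    then have "a mod int m = b mod int m"
      by (simp add: mod_eq_dvd_iff)
    then show "a = b" by (rule centred_inj[OF ab(1,2)])
  qed
  then have bij: "bij_betw ?f (centred m) (centred m)"
    using endo_inj_surj[OF finite_centred, of ?f m] crep_centred[OF m]
    by (simp add: bij_betw_def image_subset_iff)
  have "?S = (\<Sum>a\<in>centred m. zchar m (?f a * w))"
    by (rule sum.reindex_bij_betw[OF bij, symmetric])
  also have "\<dots> = (\<Sum>a\<in>centred m. zchar m (a * w) * zchar m w)"
  proof (rule sum.cong[OF refl])
    fix a
    have "zchar m (?f a * w) = zchar m ((a + 1) * w)"
      by (rule zchar_cong[OF m]) (metis crep_mod mod_mult_left_eq)
    then show "zchar m (?f a * w) = zchar m (a * w) * zchar m w"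
      by (simp add: ring_distribs zchar_add)
  qed
  also have "\<dots> = ?S * zchar m w" by (rule sum_distrib_right[symmetric])
  finally have "?S * (1 - zchar m w) = 0" by (simp add: right_diff_distrib)
  then show ?thesis using False zchar_eq_1_iff[OF m, of w] by simp
qed

lemma sum_zchar_Zmd:
  assumes m: "m > 0"
  shows "(\<Sum>x\<in>Zmd m d. zchar m (zinner d x w)) = (if \<forall>i<d. int m dvd w i then of_nat m ^ d else 0)"
proof -
  have "(\<Sum>x\<in>Zmd m d. zchar m (zinner d x w)) = (\<Sum>x\<in>Zmd m d. \<Prod>i<d. zchar m (x i * w i))"
    by (simp add: zinner_def zchar_sum)
  also have "\<dots> = (\<Prod>i<d. \<Sum>a\<in>centred m. zchar m (a * w i))"
    unfolding Zmd_def by (rule prod_sum_PiE[symmetric]) (simp_all add: finite_centred)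
  also have "\<dots> = (\<Prod>i<d. if int m dvd w i then of_nat m else 0)"
    by (simp add: sum_zchar_centred[OF m])
  also have "\<dots> = (if \<forall>i<d. int m dvd w i then of_nat m ^ d else 0)"
    by auto
  finally show ?thesis .
qed

lemma orbit_subset_Zmd: "m > 0 \<Longrightarrow> X \<in> orbits m d \<Longrightarrow> X \<subseteq> Zmd m d"
  unfolding orbits_def by (rule in_quotient_imp_subset[OF equiv_Gd_rel])

lemma finite_orbit: "m > 0 \<Longrightarrow> X \<in> orbits m d \<Longrightarrow> finite X"
  using finite_subset[OF orbit_subset_Zmd finite_Zmd] by blast

lemma orbit_nonempty: "m > 0 \<Longrightarrow> X \<in> orbits m d \<Longrightarrow> X \<noteq> {}"
  unfolding orbits_def by (rule in_quotient_imp_non_empty[OF equiv_Gd_rel])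

lemma finite_orbits: "m > 0 \<Longrightarrow> finite (orbits m d)"
  using finite_subset[of "orbits m d" "Pow (Zmd m d)"] orbit_subset_Zmd finite_Zmd by auto

lemma orbit_eq_iff:
  assumes m: "m > 0" and X: "X \<in> orbits m d" and Y: "Y \<in> orbits m d" and x: "x \<in> X"
  shows "x \<in> Y \<longleftrightarrow> X = Y"
proof -
  have "X = Y \<or> X \<inter> Y = {}"
    by (rule quotient_disj[OF equiv_Gd_rel[OF m] X[unfolded orbits_def] Y[unfolded orbits_def]])
  then show ?thesis using x by blast
qed

lemma sum_over_orbits:
  assumes m: "m > 0"
  shows "(\<Sum>X\<in>orbits m d. \<Sum>x\<in>X. f x) = (\<Sum>x\<in>Zmd m d. f x)"
proof -
  have "(\<Sum>x\<in>\<Union>(orbits m d). f x) = (\<Sum>X\<in>orbits m d. \<Sum>x\<in>X. f x)"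
  proof (subst sum.Union_disjoint)
    show "\<forall>X\<in>orbits m d. finite X" using finite_orbit[OF m] by blast
    show "\<forall>X\<in>orbits m d. \<forall>Y\<in>orbits m d. X \<noteq> Y \<longrightarrow> X \<inter> Y = {}"
      using orbit_eq_iff[OF m] by (meson disjoint_iff)
  qed simp
  moreover have "\<Union>(orbits m d) = Zmd m d"
    unfolding orbits_def by (rule Union_quotient[OF equiv_Gd_rel[OF m]])
  ultimately show ?thesis by simp
qed

lemma orbit_of_in_orbits: "x \<in> Zmd m d \<Longrightarrow> orbit_of m d x \<in> orbits m d"
  unfolding orbit_of_def orbits_def by (rule quotientI)

lemma mem_orbit_of: "m > 0 \<Longrightarrow> x \<in> Zmd m d \<Longrightarrow> x \<in> orbit_of m d x"
  unfolding orbit_of_def using equiv_class_self[OF equiv_Gd_rel] by blast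

lemma sym_dft_zchar:
  assumes "m > 0" "X \<in> orbits m d" "Y \<in> orbits m d" "x \<in> X"
  shows "sym_dft m d X Y = complex_of_real (real m powr (- real d / 2)) *
    (\<Sum>z\<in>Y. zchar m (zinner d x z))"
  unfolding zchar_def by (rule sym_dft_eq[OF assms])

lemma zinner_commute: "zinner d x y = zinner d y x"
  by (simp add: zinner_def mult.commute)

text \<open>Both sides are the normalized sum of the characters over \<open>X \<times> Y\<close>. This lets the sum over the arbitrary
  orbit \<open>Y\<close> be traded for a sum over the few explicit orbits on which \<open>\<lambda>\<close> is nonzero.\<close>

lemma sym_dft_card_swap:
  assumes m: "m > 0" and X: "X \<in> orbits m d" and Y: "Y \<in> orbits m d"
  shows "of_nat (card X) * sym_dft m d X Y = of_nat (card Y) * sym_dft m d Y X"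
proof -
  let ?c = "complex_of_real (real m powr (- real d / 2))"
  have "of_nat (card X) * sym_dft m d X Y = (\<Sum>x\<in>X. ?c * (\<Sum>y\<in>Y. zchar m (zinner d x y)))"
    using sum.cong[OF refl sym_dft_zchar[OF m X Y], of X] by simp
  also have "\<dots> = (\<Sum>y\<in>Y. ?c * (\<Sum>x\<in>X. zchar m (zinner d y x)))"
    unfolding sum_distrib_left by (subst sum.swap) (simp add: zinner_commute)
  also have "\<dots> = of_nat (card Y) * sym_dft m d Y X"
    using sum.cong[OF refl sym_dft_zchar[OF m Y X], of Y] by simp
  finally show ?thesis .
qed

text \<open>Fourier inversion gives the reflection \<open>z \<mapsto> -z\<close> rather than the identity, but \<open>-z\<close> lies in
  the orbit of \<open>z\<close>, since all signs may be changed.\<close>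

lemma sym_dft_involutive:
  assumes m: "m > 0" and Z: "Z \<in> orbits m d" and Y: "Y \<in> orbits m d"
  shows "(\<Sum>X\<in>orbits m d. sym_dft m d Z X * sym_dft m d X Y) = (if Z = Y then 1 else 0)"
proof -
  let ?c = "complex_of_real (real m powr (- real d / 2))"
  obtain z where z: "z \<in> Z" using orbit_nonempty[OF m Z] by blast
  have zZ: "z \<in> Zmd m d" using z orbit_subset_Zmd[OF m Z] by blast
  \<comment> \<open>The vector \<open>-z\<close>, reduced to centred representatives.\<close>
  define z' where "z' = signed_perm m d (\<lambda>_. -1) id z"
  have rel: "(z, z') \<in> Gd_rel m d"
    by (rule Gd_relI[OF m zZ _ permutes_id z'_def]) simp
  have z': "z' \<in> Z"
    using in_quotient_imp_closed[OF equiv_Gd_rel[OF m] Z[unfolded orbits_def] z rel] .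
  have neg: "(\<forall>i<d. int m dvd z i + y i) \<longleftrightarrow> y = z'" if y: "y \<in> Y" for y
  proof -
    have yZ: "y \<in> Zmd m d" using y orbit_subset_Zmd[OF m Y] by blast
    have z'Z: "z' \<in> Zmd m d" unfolding z'_def by (rule signed_perm_Zmd[OF m])
    have z'_mod: "z' i mod int m = (- z i) mod int m" if "i < d" for i
      unfolding z'_def using signed_perm_mod[OF that, of m "\<lambda>_. -1" id z] by simp
    have "int m dvd z i + y i \<longleftrightarrow> y i mod int m = z' i mod int m" if "i < d" for i
      unfolding z'_mod[OF that] by (simp add: mod_eq_dvd_iff add.commute)
    then show ?thesis using Zmd_eqI[OF yZ z'Z] by auto
  qed
  have "(\<Sum>X\<in>orbits m d. sym_dft m d Z X * sym_dft m d X Y)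
      = (\<Sum>X\<in>orbits m d. \<Sum>x\<in>X. ?c * zchar m (zinner d z x) * (?c * (\<Sum>y\<in>Y. zchar m (zinner d x y))))"
  proof (rule sum.cong[OF refl])
    fix X assume X: "X \<in> orbits m d"
    have "sym_dft m d Z X * sym_dft m d X Y = (\<Sum>x\<in>X. ?c * zchar m (zinner d z x) * sym_dft m d X Y)"
      unfolding sym_dft_zchar[OF m Z X z] by (simp add: sum_distrib_left sum_distrib_right)
    also have "\<dots> = (\<Sum>x\<in>X. ?c * zchar m (zinner d z x) * (?c * (\<Sum>y\<in>Y. zchar m (zinner d x y))))"
      by (intro sum.cong refl) (simp add: sym_dft_zchar[OF m X Y])
    finally show "sym_dft m d Z X * sym_dft m d X Y
      = (\<Sum>x\<in>X. ?c * zchar m (zinner d z x) * (?c * (\<Sum>y\<in>Y. zchar m (zinner d x y))))" .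
  qed
  also have "\<dots> = (\<Sum>x\<in>Zmd m d. ?c * zchar m (zinner d z x) * (?c * (\<Sum>y\<in>Y. zchar m (zinner d x y))))"
    by (rule sum_over_orbits[OF m])
  also have "\<dots> = ?c ^ 2 * (\<Sum>x\<in>Zmd m d. \<Sum>y\<in>Y. zchar m (zinner d x (\<lambda>i. z i + y i)))"
  proof -
    have "zinner d x (\<lambda>i. z i + y i) = zinner d z x + zinner d x y" for x y
      by (simp add: zinner_def ring_distribs sum.distrib mult.commute)
    then have "?c * zchar m (zinner d z x) * (?c * (\<Sum>y\<in>Y. zchar m (zinner d x y)))
        = ?c ^ 2 * (\<Sum>y\<in>Y. zchar m (zinner d x (\<lambda>i. z i + y i)))" for x
      by (simp add: zchar_add power2_eq_square flip: sum_distrib_left)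
    then show ?thesis by (simp only: sum_distrib_left)
  qed
  also have "\<dots> = ?c ^ 2 * (\<Sum>y\<in>Y. if \<forall>i<d. int m dvd z i + y i then of_nat m ^ d else 0)"
    by (subst sum.swap) (simp add: sum_zchar_Zmd[OF m])
  also have "\<dots> = ?c ^ 2 * (\<Sum>y\<in>Y. if y = z' then of_nat m ^ d else 0)"
    using neg by simp
  also have "\<dots> = (if z' \<in> Y then ?c ^ 2 * of_nat m ^ d else 0)"
    using finite_orbit[OF m Y] by simp
  also have "z' \<in> Y \<longleftrightarrow> Z = Y" by (rule orbit_eq_iff[OF m Z Y z'])
  also have "?c ^ 2 * of_nat m ^ d = 1"
  proof -
    have "(real m powr (- real d / 2)) ^ 2 * real m ^ d = 1"
      using m by (simp add: powr_realpow[symmetric] power2_eq_square flip: powr_add)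
    then have "complex_of_real ((real m powr (- real d / 2)) ^ 2 * real m ^ d) = 1"
      by (simp only: of_real_1)
    then show ?thesis by simp
  qed
  finally show ?thesis .
qed

lemma is_dft_transpose_sym:
  assumes m: "m > 0" and uv: "is_dft_transpose m d u v"
  shows "is_dft_transpose m d v u"
  unfolding is_dft_transpose_def
proof
  fix Y assume Y: "Y \<in> orbits m d"
  have "(\<Sum>X\<in>orbits m d. sym_dft m d X Y * complex_of_real (v X))
      = (\<Sum>X\<in>orbits m d. sym_dft m d X Y * (\<Sum>Z\<in>orbits m d. sym_dft m d Z X * complex_of_real (u Z)))"
    using uv by (simp add: is_dft_transpose_def)
  also have "\<dots> = (\<Sum>Z\<in>orbits m d. (\<Sum>X\<in>orbits m d. sym_dft m d Z X * sym_dft m d X Y) * complex_of_real (u Z))"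
    unfolding sum_distrib_left sum_distrib_right by (subst sum.swap) (simp add: mult_ac)
  also have "\<dots> = (\<Sum>Z\<in>orbits m d. if Z = Y then complex_of_real (u Z) else 0)"
    using sym_dft_involutive[OF m _ Y] by (intro sum.cong) auto
  also have "\<dots> = complex_of_real (u Y)"
    using Y finite_orbits[OF m] by simp
  finally show "complex_of_real (u Y) = (\<Sum>X\<in>orbits m d. sym_dft m d X Y * complex_of_real (v X))" ..
qed

section \<open>Orbits are determined by the counts of absolute values\<close>

lemma abs_crep_sign:
  assumes m: "m > 0" and a: "a \<in> centred m" and s: "s \<in> {1, -1}"
  shows "\<bar>crep m (s * a)\<bar> = \<bar>a\<bar>"
proof (cases "s * a \<in> centred m")
  case True
  then have "crep m (s * a) = s * a" using crep_eq_iff[OF m] by blast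
  then show ?thesis using s by auto
next
  case False
  then have "s = -1" "int m = 2 * a" using s a by (auto simp: mem_centred)
  moreover have "a mod int m = (- a) mod int m"
  proof -
    have "a - - a = int m" using \<open>int m = 2 * a\<close> by linarith
    then show ?thesis by (metis dvd_refl mod_eq_dvd_iff)
  qed
  ultimately have "crep m (s * a) = a" using a crep_eq_iff[OF m, of "- a" a] by simp
  then show ?thesis by simp
qed

text \<open>Signed permutations rearrange the absolute values of the centred representatives (the
  representative \<open>m/2\<close> is its own negative); conversely, a permutation that matches the absolute
  values is completed by a choice of signs.\<close>

lemma Gd_rel_iff:
  assumes m: "m > 0" and x: "x \<in> Zmd m d" and y: "y \<in> Zmd m d"
  shows "(x, y) \<in> Gd_rel m d \<longleftrightarrow> (\<forall>v. card {i\<in>{..<d}. \<bar>x i\<bar> = v} = card {i\<in>{..<d}. \<bar>y i\<bar> = v})"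
proof
  assume "(x, y) \<in> Gd_rel m d"
  then obtain s p where s: "\<forall>i<d. s i \<in> {1, -1}" and p: "p permutes {..<d}"
    and y_eq: "y = signed_perm m d s p x" by (auto simp: Gd_rel_def)
  have abs_y: "\<bar>y i\<bar> = \<bar>x (p i)\<bar>" if "i < d" for i
  proof -
    have "x (p i) \<in> centred m" using x permutes_lessThan_lt[OF p that] by (auto simp: Zmd_def)
    then show ?thesis using abs_crep_sign[OF m] s that by (simp add: y_eq signed_perm_def)
  qed
  show "\<forall>v. card {i\<in>{..<d}. \<bar>x i\<bar> = v} = card {i\<in>{..<d}. \<bar>y i\<bar> = v}"
  proof
    fix v
    have "{i\<in>{..<d}. \<bar>x i\<bar> = v} = {i\<in>p ` {..<d}. \<bar>x i\<bar> = v}"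
      by (simp add: permutes_image[OF p])
    also have "\<dots> = p ` {i\<in>{..<d}. \<bar>y i\<bar> = v}"
      using abs_y by (auto simp del: permutes_image)
    finally show "card {i\<in>{..<d}. \<bar>x i\<bar> = v} = card {i\<in>{..<d}. \<bar>y i\<bar> = v}"
      by (simp add: card_image permutes_inj_on[OF p])
  qed
next
  assume eq: "\<forall>v. card {i\<in>{..<d}. \<bar>x i\<bar> = v} = card {i\<in>{..<d}. \<bar>y i\<bar> = v}"
  have "image_mset (\<lambda>i. \<bar>y i\<bar>) (mset_set {..<d}) = image_mset (\<lambda>i. \<bar>x i\<bar>) (mset_set {..<d})"
    using eq by (intro multiset_eqI) (simp add: count_image_mset_eq_card_vimage)
  then obtain p where p: "p permutes {..<d}" and abs_eq: "\<forall>i\<in>{..<d}. \<bar>y i\<bar> = \<bar>x (p i)\<bar>"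
    using image_mset_eq_implies_permutes[of "{..<d}"] by blast
  define s :: "nat \<Rightarrow> int" where "s i = (if y i = x (p i) then 1 else -1)" for i
  have "y = signed_perm m d s p x"
  proof (rule Zmd_eqI[OF y signed_perm_Zmd[OF m]])
    fix i assume i: "i < d"
    have "y i = s i * x (p i)" using abs_eq i by (auto simp: s_def abs_eq_iff)
    then show "y i mod int m = signed_perm m d s p x i mod int m"
      by (simp add: signed_perm_mod[OF i])
  qed
  then show "(x, y) \<in> Gd_rel m d"
    using Gd_relI[OF m x _ p, of s y] by (simp add: s_def)
qed

lemma centred_4: "centred 4 = {-1, 0, 1, 2}"
  by (auto simp: mem_centred)

lemma Zmd_4_values: "x \<in> Zmd 4 d \<Longrightarrow> i < d \<Longrightarrow> x i = -1 \<or> x i = 0 \<or> x i = 1 \<or> x i = 2"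
  unfolding Zmd_def centred_4 by (auto simp: PiE_iff)

lemma card_abs_Zmd_4:
  assumes x: "x \<in> Zmd 4 d"
  shows "card {i\<in>{..<d}. \<bar>x i\<bar> = v} =
    (if v = 0 then card {i\<in>{..<d}. x i = 0} else if v = 2 then card {i\<in>{..<d}. x i = 2}
     else if v = 1 then d - card {i\<in>{..<d}. x i = 0} - card {i\<in>{..<d}. x i = 2} else 0)"
proof -
  have split: "{..<d} = {i\<in>{..<d}. \<bar>x i\<bar> = 1} \<union> ({i\<in>{..<d}. x i = 0} \<union> {i\<in>{..<d}. x i = 2})"
    using Zmd_4_values[OF x] by force
  have "card {..<d} = card {i\<in>{..<d}. \<bar>x i\<bar> = 1} + card ({i\<in>{..<d}. x i = 0} \<union> {i\<in>{..<d}. x i = 2})"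
    by (subst split, rule card_Un_disjoint) auto
  also have "card ({i\<in>{..<d}. x i = 0} \<union> {i\<in>{..<d}. x i = 2})
      = card {i\<in>{..<d}. x i = 0} + card {i\<in>{..<d}. x i = 2}"
    by (rule card_Un_disjoint) auto
  finally have "card {i\<in>{..<d}. \<bar>x i\<bar> = 1} = d - card {i\<in>{..<d}. x i = 0} - card {i\<in>{..<d}. x i = 2}"
    unfolding card_lessThan by linarith
  moreover have "{i\<in>{..<d}. \<bar>x i\<bar> = 2} = {i\<in>{..<d}. x i = 2}"
    using Zmd_4_values[OF x] by force
  moreover have "{i\<in>{..<d}. \<bar>x i\<bar> = v} = {}" if "v \<noteq> 0" "v \<noteq> 1" "v \<noteq> 2"
    using that Zmd_4_values[OF x] by force
  ultimately show ?thesis by auto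
qed

lemma orbit012_eq:
  assumes d: "a + b + c = d"
  shows "orbit012 a b c = {x \<in> Zmd 4 d. card {i\<in>{..<d}. x i = 0} = a \<and> card {i\<in>{..<d}. x i = 2} = c}"
proof -
  let ?e = "elem012 a b c"
  have e: "?e \<in> Zmd 4 d" using d by (auto simp: elem012_def Zmd_def mem_centred)
  have "{i\<in>{..<d}. ?e i = 0} = {..<a}" "{i\<in>{..<d}. ?e i = 2} = {a + b..<d}"
    using d by (auto simp: elem012_def)
  then have counts: "card {i\<in>{..<d}. ?e i = 0} = a" "card {i\<in>{..<d}. ?e i = 2} = c"
    using d by auto
  have "(?e, x) \<in> Gd_rel 4 d \<longleftrightarrow> card {i\<in>{..<d}. x i = 0} = a \<and> card {i\<in>{..<d}. x i = 2} = c"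
    if x: "x \<in> Zmd 4 d" for x
    unfolding Gd_rel_iff[OF zero_less_numeral e x]
  proof
    assume eq: "\<forall>v. card {i\<in>{..<d}. \<bar>?e i\<bar> = v} = card {i\<in>{..<d}. \<bar>x i\<bar> = v}"
    show "card {i\<in>{..<d}. x i = 0} = a \<and> card {i\<in>{..<d}. x i = 2} = c"
      using eq[THEN spec, of 0] eq[THEN spec, of 2] counts
      unfolding card_abs_Zmd_4[OF e] card_abs_Zmd_4[OF x] by simp
  next
    assume "card {i\<in>{..<d}. x i = 0} = a \<and> card {i\<in>{..<d}. x i = 2} = c"
    then show "\<forall>v. card {i\<in>{..<d}. \<bar>?e i\<bar> = v} = card {i\<in>{..<d}. \<bar>x i\<bar> = v}"
      unfolding card_abs_Zmd_4[OF e] card_abs_Zmd_4[OF x] counts by simp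
  qed
  moreover have "x \<in> Zmd 4 d" if "(?e, x) \<in> Gd_rel 4 d" for x
    using that by (simp add: Gd_rel_def)
  ultimately show ?thesis
    unfolding orbit012_def orbit_of_def d by blast
qed

lemma orbit012_in_orbits: "a + b + c = d \<Longrightarrow> orbit012 a b c \<in> orbits 4 d"
  unfolding orbit012_def
  by (auto intro!: orbit_of_in_orbits simp: elem012_def Zmd_def mem_centred)

section \<open>Character sums over the orbits that carry \<open>\<lambda>\<close>\<close>

lemma zchar_4_values: "zchar 4 1 = - \<i>" "zchar 4 (-1) = \<i>" "zchar 4 2 = -1" "zchar 4 (-2) = -1"
proof -
  show one: "zchar 4 1 = - \<i>"
    by (simp add: zchar_def exp_eq_polar cis_conv_exp flip: cis_conv_exp)
  show two: "zchar 4 2 = -1"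
    using zchar_add[of 4 1 1] one by simp
  show "zchar 4 (-1) = \<i>"
  proof -
    have "zchar 4 (-1) * \<i> = -1" using zchar_add[of 4 "-1" 1] one by (simp add: minus_equation_iff)
    then have "zchar 4 (-1) * \<i> * - \<i> = \<i>" by simp
    then show ?thesis by (simp add: mult.assoc)
  qed
  show "zchar 4 (-2) = -1"
    using zchar_cong[of 4 "-2" 2] two by simp
qed

lemma zchar_4_double: "zchar 4 (y * 2) = (if odd y then -1 else 1)"
proof (cases "odd y")
  case True
  then obtain k where "y = 2 * k + 1" by (rule oddE)
  then have "(y * 2) mod 4 = 2 mod 4" by (simp add: ring_distribs mod_eq_dvd_iff)
  then show ?thesis using True zchar_cong[of 4 "y * 2" 2] by (simp add: zchar_4_values)
next
  case False
  then have "(y * 2) mod 4 = 0 mod 4" by (auto elim!: evenE)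
  then show ?thesis using False zchar_cong[of 4 "y * 2" 0] by simp
qed

lemma prod_zchar_twos:
  assumes "finite A" "S \<subseteq> A"
  shows "(\<Prod>i\<in>A. zchar 4 (y i * (if i \<in> S then 2 else 0))) = (-1) ^ card (S \<inter> {i\<in>A. odd (y i)})"
proof -
  have fin: "finite S" using assms finite_subset by blast
  have "(\<Prod>i\<in>A. zchar 4 (y i * (if i \<in> S then 2 else 0))) = (\<Prod>i\<in>S. if odd (y i) then -1 else 1)"
    using assms by (intro prod.mono_neutral_cong_right) (auto simp: zchar_4_double)
  also have "\<dots> = (\<Prod>i\<in>{i\<in>S. odd (y i)}. -1)"
    by (rule prod.inter_filter[OF fin, symmetric])
  also have "{i\<in>S. odd (y i)} = S \<inter> {i\<in>A. odd (y i)}" using assms(2) by auto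
  finally show ?thesis by simp
qed

lemma complex_sum_subsets_eq_krawtchouk:
  assumes A: "finite A" and B: "B \<subseteq> A"
  shows "(\<Sum>S | S \<subseteq> A \<and> card S = s. (-1 :: complex) ^ card (S \<inter> B)) = of_real (krawtchouk (card A) s (card B))"
  unfolding sum_subsets_eq_krawtchouk[OF assms, symmetric] by simp

text \<open>The vectors of this orbit correspond to the sets of places of their twos, and an entry \<open>2\<close>
  contributes the sign \<open>-1\<close> exactly at the odd places of \<open>y\<close>.\<close>

lemma sum_zchar_orbit_zeros_twos:
  assumes d: "a + c = d"
  shows "(\<Sum>x\<in>orbit012 a 0 c. zchar 4 (zinner d y x)) = of_real (krawtchouk d c (card {i\<in>{..<d}. odd (y i)}))"
proof -
  let ?B = "{i\<in>{..<d}. odd (y i)}"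
  define twos :: "nat set \<Rightarrow> nat \<Rightarrow> int" where "twos S = (\<lambda>i\<in>{..<d}. if i \<in> S then 2 else 0)" for S
  have "(\<Sum>S | S \<subseteq> {..<d} \<and> card S = c. (-1) ^ card (S \<inter> ?B)) = (\<Sum>x\<in>orbit012 a 0 c. zchar 4 (zinner d y x))"
  proof (rule sum.reindex_bij_witness[where j = twos and i = "\<lambda>x. {i\<in>{..<d}. x i = 2}"])
    fix S assume S: "S \<in> {S. S \<subseteq> {..<d} \<and> card S = c}"
    show two_set: "{i\<in>{..<d}. twos S i = 2} = S" using S by (auto simp: twos_def)
    have "{i\<in>{..<d}. twos S i = 0} = {..<d} - S" by (auto simp: twos_def)
    then have "card {i\<in>{..<d}. twos S i = 0} = a"
      using S d finite_subset[of S "{..<d}"] by (simp add: card_Diff_subset)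
    then show "twos S \<in> orbit012 a 0 c"
      using S d two_set by (subst orbit012_eq[of _ _ _ d]) (auto simp: twos_def Zmd_def centred_4)
    have "zchar 4 (zinner d y (twos S)) = (\<Prod>i<d. zchar 4 (y i * (if i \<in> S then 2 else 0)))"
      unfolding zinner_def zchar_sum by (simp add: twos_def)
    then show "zchar 4 (zinner d y (twos S)) = (-1) ^ card (S \<inter> ?B)"
      using S prod_zchar_twos[of "{..<d}" S y] by simp
  next
    fix x assume "x \<in> orbit012 a 0 c"
    then have x: "x \<in> Zmd 4 d" and counts: "card {i\<in>{..<d}. x i = 0} = a" "card {i\<in>{..<d}. x i = 2} = c"
      using orbit012_eq[of a 0 c d] d by auto
    then show "{i\<in>{..<d}. x i = 2} \<in> {S. S \<subseteq> {..<d} \<and> card S = c}" by auto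
    have "card {i\<in>{..<d}. \<bar>x i\<bar> = 1} = 0"
      using card_abs_Zmd_4[OF x, of 1] counts d by simp
    then have "\<bar>x i\<bar> \<noteq> 1" if "i < d" for i using that by auto
    then have "x i = (if x i = 2 then 2 else 0)" if "i < d" for i
      using Zmd_4_values[OF x that] that by fastforce
    then show "twos {i\<in>{..<d}. x i = 2} = x"
      using x unfolding Zmd_def twos_def by (intro ext) (auto simp: PiE_def extensional_def)
  qed
  moreover have "?B \<subseteq> {..<d}" by blast
  ultimately show ?thesis using complex_sum_subsets_eq_krawtchouk[of "{..<d}" ?B c] by simp
qed

text \<open>A vector of this orbit is given by the place \<open>j\<close> and the sign \<open>s\<close> of its odd entry and the
  set \<open>S\<close> of its twos. Summing over the sign gives \<open>2\<close>, \<open>-2\<close> or \<open>0\<close> according to whether \<open>y\<^sub>j\<close> is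
  \<open>0\<close>, \<open>2\<close> or odd; so \<open>j\<close> may be taken outside the odd places of \<open>y\<close>, and the sum over \<open>S\<close> no
  longer depends on \<open>j\<close>.\<close>

lemma sum_zchar_orbit_single_one:
  assumes d: "a + 1 + c = d" and y: "y \<in> Zmd 4 d"
  shows "(\<Sum>x\<in>orbit012 a 1 c. zchar 4 (zinner d y x)) =
    of_real (2 * (real (card {i\<in>{..<d}. y i = 0}) - real (card {i\<in>{..<d}. y i = 2}))
      * krawtchouk (d - 1) c (card {i\<in>{..<d}. odd (y i)}))"
proof -
  let ?B = "{i\<in>{..<d}. odd (y i)}"
  let ?Ss = "\<lambda>j. {S. S \<subseteq> {..<d} - {j} \<and> card S = c}"
  define T where "T = Sigma {..<d} (\<lambda>j. {1, -1 :: int} \<times> ?Ss j)"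
  define f :: "nat \<times> int \<times> nat set \<Rightarrow> nat \<Rightarrow> int"
    where "f = (\<lambda>(j, s, S). \<lambda>i\<in>{..<d}. if i = j then s else if i \<in> S then 2 else 0)"
  have two_set: "{i\<in>{..<d}. f (j, s, S) i = 2} = S" if "(j, s, S) \<in> T" for j s S
    using that by (auto simp: f_def T_def)
  have "inj_on f T"
  proof (rule inj_onI, clarify)
    fix j s S j' s' S' assume t: "(j, s, S) \<in> T" "(j', s', S') \<in> T" and eq: "f (j, s, S) = f (j', s', S')"
    have "S = S'" using two_set[OF t(1)] two_set[OF t(2)] eq by simp
    moreover have "odd (f (j, s, S) j)" using t(1) by (auto simp: f_def T_def)
    then have "odd (f (j', s', S') j)" unfolding eq .
    then have "j = j'" using t(1) by (auto simp: f_def T_def split: if_splits)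
    moreover from this have "s = s'" using t arg_cong[OF eq, of "\<lambda>g. g j"] by (auto simp: f_def T_def)
    ultimately show "j = j' \<and> (s, S) = (s', S')" by simp
  qed
  moreover have "f ` T = orbit012 a 1 c"
  proof (intro equalityI subsetI)
    fix x assume "x \<in> f ` T"
    then obtain j s S where t: "(j, s, S) \<in> T" and x: "x = f (j, s, S)" by auto
    have "{i\<in>{..<d}. x i = 0} = {..<d} - insert j S"
      using t unfolding x by (auto simp: f_def T_def)
    moreover have "finite S" "j \<notin> S" "insert j S \<subseteq> {..<d}" "card S = c"
      using t finite_subset[of S "{..<d} - {j}"] by (auto simp: T_def)
    ultimately have "card {i\<in>{..<d}. x i = 0} = a" using d by (simp add: card_Diff_subset)
    moreover have "card {i\<in>{..<d}. x i = 2} = c" using two_set[OF t] t by (simp add: x T_def)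
    moreover have "x \<in> Zmd 4 d" using t unfolding x by (auto simp: f_def T_def Zmd_def centred_4 split: if_splits)
    ultimately show "x \<in> orbit012 a 1 c" using d by (simp add: orbit012_eq)
  next
    fix x assume "x \<in> orbit012 a 1 c"
    then have x: "x \<in> Zmd 4 d" and counts: "card {i\<in>{..<d}. x i = 0} = a" "card {i\<in>{..<d}. x i = 2} = c"
      using orbit012_eq[OF d] by auto
    have "card {i\<in>{..<d}. \<bar>x i\<bar> = 1} = 1"
      using card_abs_Zmd_4[OF x, of 1] counts d by simp
    \<comment> \<open>The counts leave room for exactly one odd entry, and its place determines \<open>j\<close>.\<close>
    then obtain j where j: "{i\<in>{..<d}. \<bar>x i\<bar> = 1} = {j}" by (auto simp: card_1_singleton_iff)
    let ?t = "(j, x j, {i\<in>{..<d}. x i = 2})"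
    have xj: "j < d" "\<bar>x j\<bar> = 1" using j by auto
    then have "?t \<in> T" using counts by (auto simp: T_def abs_if split: if_splits)
    moreover have "x = f ?t"
    proof
      fix i
      show "x i = f ?t i"
      proof (cases "i < d")
        case True
        then have "i \<noteq> j \<Longrightarrow> \<bar>x i\<bar> \<noteq> 1" using j by blast
        then show ?thesis using True Zmd_4_values[OF x True] by (auto simp: f_def)
      qed (use x in \<open>auto simp: f_def Zmd_def PiE_def extensional_def\<close>)
    qed
    ultimately show "x \<in> f ` T" by blast
  qed
  ultimately have "(\<Sum>x\<in>orbit012 a 1 c. zchar 4 (zinner d y x)) = (\<Sum>t\<in>T. zchar 4 (zinner d y (f t)))"
    using sum.reindex[of f T "\<lambda>x. zchar 4 (zinner d y x)"] by simp
  also have "\<dots> = (\<Sum>(j, s, S)\<in>T. zchar 4 (y j * s) * (-1) ^ card (S \<inter> (?B - {j})))"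
  proof (rule sum.cong[OF refl], clarify)
    fix j s S assume t: "(j, s, S) \<in> T"
    have "zchar 4 (zinner d y (f (j, s, S))) = (\<Prod>i\<in>{..<d}. zchar 4 (y i * f (j, s, S) i))"
      unfolding zinner_def zchar_sum ..
    also have "\<dots> = zchar 4 (y j * f (j, s, S) j) * (\<Prod>i\<in>{..<d} - {j}. zchar 4 (y i * f (j, s, S) i))"
      using t by (intro prod.remove) (auto simp: T_def)
    also have "(\<Prod>i\<in>{..<d} - {j}. zchar 4 (y i * f (j, s, S) i))
        = (\<Prod>i\<in>{..<d} - {j}. zchar 4 (y i * (if i \<in> S then 2 else 0)))"
      by (intro prod.cong) (auto simp: f_def)
    also have "\<dots> = (-1) ^ card (S \<inter> {i\<in>{..<d} - {j}. odd (y i)})"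
      using t by (intro prod_zchar_twos) (auto simp: T_def)
    also have "{i\<in>{..<d} - {j}. odd (y i)} = ?B - {j}" by auto
    also have "f (j, s, S) j = s" using t by (auto simp: f_def T_def)
    finally show "zchar 4 (zinner d y (f (j, s, S))) = zchar 4 (y j * s) * (-1) ^ card (S \<inter> (?B - {j}))" .
  qed
  also have "\<dots> = (\<Sum>j<d. \<Sum>s\<in>{1, -1}. \<Sum>S\<in>?Ss j. zchar 4 (y j * s) * (-1) ^ card (S \<inter> (?B - {j})))"
    unfolding T_def by (simp add: sum.Sigma sum.cartesian_product)
  also have "\<dots> = (\<Sum>j<d. (if y j = 0 then 2 else if y j = 2 then -2 else 0) * of_real (krawtchouk (d - 1) c (card ?B)))"
  proof (rule sum.cong[OF refl])
    fix j assume "j \<in> {..<d}"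
    then have j: "j < d" by simp
    have chars: "zchar 4 (y j) + zchar 4 (- y j) = (if y j = 0 then 2 else if y j = 2 then -2 else 0)"
      using Zmd_4_values[OF y j] by (auto simp: zchar_4_values)
    have "(\<Sum>S\<in>?Ss j. (-1 :: complex) ^ card (S \<inter> (?B - {j}))) = of_real (krawtchouk (d - 1) c (card (?B - {j})))"
      using complex_sum_subsets_eq_krawtchouk[of "{..<d} - {j}" "?B - {j}" c] j by auto
    then have "(\<Sum>s\<in>{1, -1}. \<Sum>S\<in>?Ss j. zchar 4 (y j * s) * (-1) ^ card (S \<inter> (?B - {j})))
        = (zchar 4 (y j) + zchar 4 (- y j)) * of_real (krawtchouk (d - 1) c (card (?B - {j})))"
      by (simp add: sum_distrib_left[symmetric] ring_distribs)
    also have "\<dots> = (if y j = 0 then 2 else if y j = 2 then -2 else 0) * of_real (krawtchouk (d - 1) c (card ?B))"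
      unfolding chars by simp
    finally show "(\<Sum>s\<in>{1, -1}. \<Sum>S\<in>?Ss j. zchar 4 (y j * s) * (-1) ^ card (S \<inter> (?B - {j})))
        = (if y j = 0 then 2 else if y j = 2 then -2 else 0) * of_real (krawtchouk (d - 1) c (card ?B))" .
  qed
  also have "\<dots> = (\<Sum>j<d. if y j = 0 then 2 else if y j = 2 then -2 else 0) * of_real (krawtchouk (d - 1) c (card ?B))"
    by (rule sum_distrib_right[symmetric])
  also have "(\<Sum>j<d. if y j = 0 then 2 else if y j = 2 then -2 else 0 :: complex)
      = (\<Sum>j<d. if y j = 0 then 2 else 0) - (\<Sum>j<d. if y j = 2 then 2 else 0)"
    unfolding sum_subtractf[symmetric] by (intro sum.cong) auto
  also have "\<dots> = of_real (2 * (real (card {i\<in>{..<d}. y i = 0}) - real (card {i\<in>{..<d}. y i = 2})))"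
    by (simp add: sum.If_cases Int_def ring_distribs)
  finally show ?thesis by simp
qed

text \<open>An entry of the transform read off from the character sum over the row orbit \<open>X\<close> instead of the
  column orbit \<open>Y\<close>.\<close>

lemma sym_dft_orbit_column:
  assumes m: "m > 0" and X: "X \<in> orbits m d" and Y: "Y \<in> orbits m d" and y: "y \<in> Y"
    and S: "(\<Sum>x\<in>X. zchar m (zinner d y x)) = of_real s" and n: "real (card X) = n"
  shows "sym_dft m d X Y = of_real (real m powr (- real d / 2) * real (card Y) * (s / n))"
proof -
  have "n \<noteq> 0" using n finite_orbit[OF m X] orbit_nonempty[OF m X] by auto
  moreover have "complex_of_real n * sym_dft m d X Y
      = of_nat (card Y) * (complex_of_real (real m powr (- real d / 2)) * of_real s)"
    using sym_dft_card_swap[OF m X Y] sym_dft_zchar[OF m Y X y] S n by auto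
  ultimately show ?thesis by (simp add: field_simps)
qed

text \<open>The size of an orbit is its character sum at the origin.\<close>

lemma card_orbit_zeros_twos:
  assumes "a + c = d"
  shows "card (orbit012 a 0 c) = d choose c"
proof -
  have "complex_of_real (real (card (orbit012 a 0 c))) = of_real (real (d choose c))"
    using sum_zchar_orbit_zeros_twos[OF assms, of "\<lambda>_. 0"] assms by (simp add: zinner_def krawtchouk_0_right)
  then show ?thesis by (simp only: of_real_eq_iff of_nat_eq_iff)
qed

lemma card_orbit_single_one:
  assumes "a + 1 + c = d"
  shows "card (orbit012 a 1 c) = 2 * d * ((d - 1) choose c)"
proof -
  let ?o = "\<lambda>i\<in>{..<d}. 0 :: int"
  have o: "?o \<in> Zmd 4 d" by (simp add: Zmd_def centred_4)
  have counts: "{i\<in>{..<d}. ?o i = 0} = {..<d}" "{i\<in>{..<d}. ?o i = 2} = {}" "{i\<in>{..<d}. odd (?o i)} = {}"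
    by auto
  have "complex_of_real (real (card (orbit012 a 1 c))) = of_real (real (2 * d * ((d - 1) choose c)))"
    using sum_zchar_orbit_single_one[OF assms o] assms unfolding counts
    by (simp add: zinner_def krawtchouk_0_right)
  then show ?thesis by (simp only: of_real_eq_iff of_nat_eq_iff)
qed

lemma Zmd_4_counts:
  assumes x: "x \<in> Zmd 4 d"
  shows "card {i\<in>{..<d}. x i = 0} + card {i\<in>{..<d}. odd (x i)} + card {i\<in>{..<d}. x i = 2} = d"
proof -
  have "card {i\<in>{..<d}. x i = 0} + (card {i\<in>{..<d}. odd (x i)} + card {i\<in>{..<d}. x i = 2})
      = card {i\<in>{..<d}. x i = 0} + card ({i\<in>{..<d}. odd (x i)} \<union> {i\<in>{..<d}. x i = 2})"
    by (subst card_Un_disjoint) auto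
  also have "\<dots> = card ({i\<in>{..<d}. x i = 0} \<union> ({i\<in>{..<d}. odd (x i)} \<union> {i\<in>{..<d}. x i = 2}))"
    by (rule card_Un_disjoint[symmetric]) auto
  also have "{i\<in>{..<d}. x i = 0} \<union> ({i\<in>{..<d}. odd (x i)} \<union> {i\<in>{..<d}. x i = 2}) = {..<d}"
    using Zmd_4_values[OF x] by force
  finally show ?thesis by simp
qed

section \<open>The transform of \<open>\<lambda>\<close>\<close>

lemma sum_orbits_lam:
  assumes k: "k > 0"
  shows "(\<Sum>X\<in>orbits 4 (2 * k + 1). f X * of_real (lam k X)) =
    of_real (2 ^ (2 * k - 1) / (real k + 1)) *
      (f (orbit012 (2 * k + 1) 0 0) + f (orbit012 0 0 (2 * k + 1))
       + of_nat k * (f (orbit012 k 0 (k + 1)) + f (orbit012 (k + 1) 0 k))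
       + of_nat (2 * k + 2) * f (orbit012 k 1 k) :: complex)"
proof -
  let ?T = "{orbit012 (2 * k + 1) 0 0, orbit012 0 0 (2 * k + 1), orbit012 k 0 (k + 1),
    orbit012 (k + 1) 0 k, orbit012 k 1 k}"
  have "(\<Sum>X\<in>orbits 4 (2 * k + 1). f X * of_real (lam k X)) = (\<Sum>X\<in>?T. f X * of_real (lam k X))"
  proof (rule sum.mono_neutral_right)
    show "?T \<subseteq> orbits 4 (2 * k + 1)" by (simp add: orbit012_in_orbits)
    show "\<forall>X\<in>orbits 4 (2 * k + 1) - ?T. f X * of_real (lam k X) = 0"
      by (auto simp: lam_def)
  qed (simp add: finite_orbits)
  also have "\<dots> = of_real (2 ^ (2 * k - 1) / (real k + 1)) *
      (f (orbit012 (2 * k + 1) 0 0) + f (orbit012 0 0 (2 * k + 1))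
       + of_nat k * (f (orbit012 k 0 (k + 1)) + f (orbit012 (k + 1) 0 k))
       + of_nat (2 * k + 2) * f (orbit012 k 1 k))"
    using k by (simp add: lam_def orbit012_eq_iff ring_distribs add_divide_distrib mult_ac)
  finally show ?thesis .
qed

lemma krawtchouk_normalized_swap:
  assumes "s \<le> n" "b \<le> n"
  shows "krawtchouk n s b / real (n choose s) = krawtchouk n b s / real (n choose b)"
  using krawtchouk_swap[OF assms] assms by (simp add: field_simps)

text \<open>The Fourier transform of \<open>\<lambda>\<close>, spread evenly over orbits, at a vector with \<open>a\<close> zeros, \<open>b\<close> odd entries
  and \<open>c\<close> twos, in units of \<open>2\<^bsup>2k-1\<^esup> / (k + 1)\<close>. The terms belong to the orbits of \<open>0\<close>, of
  \<open>(2\<^sup>d)\<close>, of the two half-filled vectors of zeros and twos, and of \<open>(0\<^sup>k, 1, 2\<^sup>k)\<close>; the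
  denominators are orbit sizes, except that a factor \<open>2\<close> is cancelled in the last one.\<close>

definition lam_hat :: "nat \<Rightarrow> nat \<Rightarrow> nat \<Rightarrow> nat \<Rightarrow> real" where
  "lam_hat k a b c =
     1 + krawtchouk (2 * k + 1) (2 * k + 1) b
     + real k * (krawtchouk (2 * k + 1) (k + 1) b / real ((2 * k + 1) choose (k + 1))
                 + krawtchouk (2 * k + 1) k b / real ((2 * k + 1) choose k))
     + (real k + 1) * (real a - real c) * 2 * krawtchouk (2 * k) k b
        / (real (2 * k + 1) * real (2 * k choose k))"

text \<open>Replacing \<open>S\<close> by its complement changes the sign when \<open>b\<close> is odd, so the contributions of
  complementary sizes cancel. The remaining term vanishes too: its middle Krawtchouk number is zero
  for odd \<open>b \<le> 2k\<close>, while \<open>b = 2k + 1\<close> forces \<open>a = c = 0\<close>.\<close>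

lemma lam_hat_odd:
  assumes abc: "a + b + c = 2 * k + 1" and b: "odd b"
  shows "lam_hat k a b c = 0"
proof -
  obtain j where j: "b = 2 * j + 1" using b by (rule oddE)
  have "krawtchouk (2 * k + 1) (2 * k + 1) b = -1" using abc b by (simp add: krawtchouk_top)
  moreover have "krawtchouk (2 * k + 1) (k + 1) b / real ((2 * k + 1) choose (k + 1))
                 + krawtchouk (2 * k + 1) k b / real ((2 * k + 1) choose k) = 0"
  proof -
    have b_le: "b \<le> 2 * k + 1" using abc by linarith
    have "krawtchouk (2 * k + 1) s b / real ((2 * k + 1) choose s) = krawtchouk (2 * k + 1) b s / real ((2 * k + 1) choose b)"
      if "s \<le> 2 * k + 1" for s
      by (rule krawtchouk_normalized_swap[OF that b_le])
    from this[of k] this[of "k + 1"] show ?thesis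
      unfolding j krawtchouk_middle_odd by simp
  qed
  moreover have "(real a - real c) * krawtchouk (2 * k) k b = 0"
  proof (cases "b \<le> 2 * k")
    case True
    then have "real (2 * k choose b) * krawtchouk (2 * k) k b = 0"
      using krawtchouk_swap[of k "2 * k" b] krawtchouk_middle_even[of k b] b by simp
    then show ?thesis using True by simp
  next
    case False
    then have "a = 0" "c = 0" using abc by auto
    then show ?thesis by simp
  qed
  ultimately show ?thesis unfolding lam_hat_def by (simp add: mult.assoc)
qed

text \<open>After \<open>krawtchouk_swap\<close> all normalized Krawtchouk numbers are the same quotient, with
  \<open>(2k choose 2j)\<close> and \<open>(2k + 1 choose 2j)\<close> related by absorption; \<open>a + c\<close> enters as
  \<open>2k + 1 - 2j\<close>.\<close>

lemma lam_hat_even: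
  assumes abc: "a + 2 * j + c = 2 * k + 1"
  shows "lam_hat k a (2 * j) c =
    2 * (1 + (-1) ^ j * (real (k choose j) / real ((2 * k + 1) choose (2 * j)))
               * (real k + (real k + 1) * ((real a - real c) / (real a + real c))))"
proof -
  let ?e = "(-1) ^ j * (real (k choose j) / real ((2 * k + 1) choose (2 * j)))"
  have j: "2 * j \<le> 2 * k" using abc by presburger
  have ac: "real a + real c = real (2 * k + 1 - 2 * j)" using abc by (simp flip: of_nat_add)
  have "krawtchouk (2 * k + 1) (2 * k + 1) (2 * j) = 1" using j by (simp add: krawtchouk_top)
  moreover have "krawtchouk (2 * k + 1) (k + 1) (2 * j) / real ((2 * k + 1) choose (k + 1)) = ?e"
    "krawtchouk (2 * k + 1) k (2 * j) / real ((2 * k + 1) choose k) = ?e"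
    using j by (subst krawtchouk_normalized_swap; simp only: krawtchouk_middle_odd; simp)+
  moreover have "krawtchouk (2 * k) k (2 * j) / (real (2 * k + 1) * real (2 * k choose k)) = ?e / (real a + real c)"
  proof -
    have "real ((2 * k + 1) choose (2 * j)) * (real a + real c) = real (2 * k + 1) * real (2 * k choose (2 * j))"
      using binomial_absorb_comp[of "2 * k + 1" "2 * j"] unfolding ac
      by (simp only: of_nat_mult[symmetric] diff_add_inverse2) (simp add: mult.commute)
    moreover have "krawtchouk (2 * k) k (2 * j) / real (2 * k choose k) = (-1) ^ j * real (k choose j) / real (2 * k choose (2 * j))"
      using j krawtchouk_middle_even[of k "2 * j"] by (simp add: krawtchouk_normalized_swap[of k _ "2 * j"])
    ultimately have "krawtchouk (2 * k) k (2 * j) / real (2 * k choose k) / real (2 * k + 1)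
        = (-1) ^ j * real (k choose j) / (real ((2 * k + 1) choose (2 * j)) * (real a + real c))"
      by (simp only: divide_divide_eq_left mult.commute)
    then show ?thesis
      by (simp only: divide_divide_eq_left times_divide_eq_right mult.commute)
  qed
  ultimately have "lam_hat k a (2 * j) c
      = 1 + 1 + real k * (?e + ?e) + (real k + 1) * (real a - real c) * 2 * (?e / (real a + real c))"
    unfolding lam_hat_def by (simp only: times_divide_eq_right[symmetric])
  then show ?thesis by (simp add: algebra_simps)
qed

text \<open>With \<open>q\<close> the quotient of binomials and \<open>e\<close> the last factor in \<open>lam_hat_even\<close>, the claim is
  \<open>(-1)\<^sup>j q e \<ge> -1\<close>. As \<open>-1 \<le> e \<le> 2k + 1\<close>, even \<open>j\<close> need only \<open>q \<le> 1\<close>, and odd \<open>j\<close> need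
  \<open>q \<le> 1 / (2k + 1)\<close>.\<close>

lemma lam_hat_nonneg:
  assumes abc: "a + b + c = 2 * k + 1"
  shows "lam_hat k a b c \<ge> 0"
proof (cases "odd b")
  case True
  then show ?thesis using lam_hat_odd[OF abc] by simp
next
  case False
  then obtain j where b: "b = 2 * j" by (auto elim: evenE)
  define q where "q = real (k choose j) / real ((2 * k + 1) choose (2 * j))"
  define w where "w = (real a - real c) / (real a + real c)"
  define e where "e = real k + (real k + 1) * w"
  have jk: "j \<le> k" using abc b by presburger
  then have pos: "real ((2 * k + 1) choose (2 * j)) > 0" by simp
  have q: "0 \<le> q" "q \<le> 1"
    using binomial_le_double[of k j] pos by (simp_all add: q_def del: binomial_Suc_Suc)
  have "a + c > 0" using abc b by presburger
  then have "real a + real c > 0" by linarith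
  then have w: "-1 \<le> w" "w \<le> 1" by (simp_all add: w_def field_simps)
  have e_lower: "-1 \<le> e"
    using mult_left_mono[OF w(1), of "real k + 1"] by (simp add: e_def)
  have e_upper: "e \<le> 2 * real k + 1"
    using mult_left_mono[OF w(2), of "real k + 1"] by (simp add: e_def)
  have "-1 \<le> (-1) ^ j * (q * e)"
  proof (cases "even j")
    case True
    have "-1 \<le> - q" using q by simp
    also have "- q \<le> q * e" using mult_left_mono[OF e_lower q(1)] by simp
    finally show ?thesis using True by simp
  next
    case False
    then have "real ((2 * k + 1) * (k choose j)) \<le> real ((2 * k + 1) choose (2 * j))"
      using double_binomial_le[of j k] jk by (simp only: of_nat_le_iff) (auto intro: Suc_leI odd_pos)
    then have "q * (2 * real k + 1) \<le> 1"
      using pos by (simp add: q_def field_simps del: binomial_Suc_Suc)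
    moreover have "q * e \<le> q * (2 * real k + 1)" by (rule mult_left_mono[OF e_upper q(1)])
    ultimately show ?thesis using False by simp
  qed
  moreover have "lam_hat k a b c = 2 * (1 + (-1) ^ j * (q * e))"
    using lam_hat_even[of a j c k] abc unfolding b q_def e_def w_def by (simp only: mult.assoc)
  ultimately show ?thesis by simp
qed

text \<open>The equality case of the two bounds behind \<open>lam_hat_nonneg\<close>: \<open>(2k + 1 choose 2) = (2k + 1) k\<close>, and
  \<open>a - c = a + c\<close>.\<close>

lemma lam_hat_two:
  assumes k: "k > 0"
  shows "lam_hat k (2 * k - 1) 2 0 = 0"
proof -
  have "(2 * k + 1) choose (2 * 1) = k * (2 * k + 1)"
    unfolding mult_1_right choose_two by simp
  then have "real ((2 * k + 1) choose (2 * 1)) = real k * (2 * real k + 1)"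
    by (simp only: of_nat_mult of_nat_add) simp
  moreover have "(real (2 * k - 1) - real 0) / (real (2 * k - 1) + real 0) = 1"
    using k by simp
  moreover have "real k / (real k * (2 * real k + 1)) * (real k + (real k + 1) * 1) = 1"
  proof -
    have pos: "real k * (2 * real k + 1) > 0" using k by (intro mult_pos_pos) auto
    have "real k / (real k * (2 * real k + 1)) * (real k + (real k + 1) * 1)
        = (real k * (2 * real k + 1)) / (real k * (2 * real k + 1))" by simp
    also have "\<dots> = 1" by (rule divide_self) (use pos in linarith)
    finally show ?thesis .
  qed
  ultimately show ?thesis
    using lam_hat_even[of "2 * k - 1" 1 0 k] k by (simp only: power_one_right) simp
qed

lemma lam_hat_zero: "lam_hat k (2 * k + 1) 0 0 = 4 * (real k + 1)"
  using lam_hat_even[of "2 * k + 1" 0 0 k] by simp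

definition lam_spectrum :: "nat \<Rightarrow> (nat \<Rightarrow> int) \<Rightarrow> real" where
  "lam_spectrum k y = 2 ^ (2 * k - 1) / (real k + 1) *
     lam_hat k (card {i\<in>{..<2 * k + 1}. y i = 0}) (card {i\<in>{..<2 * k + 1}. odd (y i)})
       (card {i\<in>{..<2 * k + 1}. y i = 2})"

lemma dft_transpose_lam:
  assumes k: "k > 0" and Y: "Y \<in> orbits 4 (2 * k + 1)" and y: "y \<in> Y"
  shows "(\<Sum>X\<in>orbits 4 (2 * k + 1). sym_dft 4 (2 * k + 1) X Y * of_real (lam k X))
    = of_real (4 powr (- real (2 * k + 1) / 2) * real (card Y) * lam_spectrum k y)"
proof -
  let ?d = "2 * k + 1"
  let ?c = "4 powr (- real ?d / 2) * real (card Y)"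
  let ?a = "card {i\<in>{..<?d}. y i = 0}" and ?b = "card {i\<in>{..<?d}. odd (y i)}"
    and ?t = "card {i\<in>{..<?d}. y i = 2}"
  have yZ: "y \<in> Zmd 4 ?d" using y orbit_subset_Zmd[OF _ Y] by auto
  have b: "?b \<le> ?d" using Zmd_4_counts[OF yZ] by linarith
  have col: "sym_dft 4 ?d (orbit012 a 0 c) Y = of_real (?c * (krawtchouk ?d c ?b / real (?d choose c)))"
    if "a + c = ?d" for a c
    using sym_dft_orbit_column[of 4 "orbit012 a 0 c" ?d Y y, OF _ _ Y y sum_zchar_orbit_zeros_twos[OF that] refl]
      orbit012_in_orbits[of a 0 c ?d] that card_orbit_zeros_twos[OF that] by simp
  have "sym_dft 4 ?d (orbit012 k 1 k) Y
      = of_real (?c * (2 * (real ?a - real ?t) * krawtchouk (?d - 1) k ?b / real (2 * ?d * ((?d - 1) choose k))))"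
    using sym_dft_orbit_column[of 4 "orbit012 k 1 k" ?d Y y, OF _ _ Y y sum_zchar_orbit_single_one[of k k ?d y, OF _ yZ] refl]
      orbit012_in_orbits[of k 1 k ?d] card_orbit_single_one[of k k ?d] by simp
  moreover have "2 * x * y / real (2 * ?d * ((?d - 1) choose k)) = x * y / (real ?d * real (2 * k choose k))"
    for x y :: real
  proof -
    have "real (2 * ?d * ((?d - 1) choose k)) = 2 * (real ?d * real (2 * k choose k))"
      by (simp add: algebra_simps)
    then show ?thesis
      by (simp only: mult.assoc mult_divide_mult_cancel_left zero_neq_numeral[symmetric]
          not_False_eq_True simp_thms)
  qed
  ultimately have one: "sym_dft 4 ?d (orbit012 k 1 k) Y
      = of_real (?c * ((real ?a - real ?t) * krawtchouk (2 * k) k ?b / (real ?d * real (2 * k choose k))))"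
    by (simp only: add_diff_cancel_right')
  \<comment> \<open>Only linearity in the five entries of the column is involved here.\<close>
  have pull_out: "of_real r * (of_real (?c * v1) + of_real (?c * v2) + of_nat k * (of_real (?c * v3) + of_real (?c * v4))
      + of_nat (2 * k + 2) * of_real (?c * v5))
    = complex_of_real (?c * (r * (v1 + v2 + real k * (v3 + v4) + (2 * real k + 2) * v5)))"
    for r v1 v2 v3 v4 v5 :: real
    by (simp add: algebra_simps)
  have total: "krawtchouk ?d 0 ?b / real (?d choose 0) + krawtchouk ?d ?d ?b / real (?d choose ?d)
      + real k * (krawtchouk ?d (k + 1) ?b / real (?d choose (k + 1)) + krawtchouk ?d k ?b / real (?d choose k))
      + (2 * real k + 2) * ((real ?a - real ?t) * krawtchouk (2 * k) k ?b / (real ?d * real (2 * k choose k)))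
    = lam_hat k ?a ?b ?t"
  proof -
    have "(2 * real k + 2) * (x * y / z) = (real k + 1) * x * 2 * y / z" for x y z :: real
      by (simp add: algebra_simps add_divide_distrib)
    then show ?thesis
      unfolding lam_hat_def krawtchouk_0_left[OF b] binomial_n_n binomial_n_0 by (simp only: of_nat_1 div_by_1)
  qed
  have cols: "sym_dft 4 ?d (orbit012 ?d 0 0) Y = of_real (?c * (krawtchouk ?d 0 ?b / real (?d choose 0)))"
    "sym_dft 4 ?d (orbit012 0 0 ?d) Y = of_real (?c * (krawtchouk ?d ?d ?b / real (?d choose ?d)))"
    "sym_dft 4 ?d (orbit012 k 0 (k + 1)) Y = of_real (?c * (krawtchouk ?d (k + 1) ?b / real (?d choose (k + 1))))"
    "sym_dft 4 ?d (orbit012 (k + 1) 0 k) Y = of_real (?c * (krawtchouk ?d k ?b / real (?d choose k)))"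
    by (rule col; simp)+
  show ?thesis
    unfolding sum_orbits_lam[OF k] cols one pull_out total lam_spectrum_def ..
qed

section \<open>Feasibility\<close>

text \<open>This identifies the vectors strictly between the origin and radius \<open>2\<close>: those without twos and
  with one, two or three odd entries.\<close>

lemma znorm_sq_Zmd_4:
  assumes x: "x \<in> Zmd 4 d"
  shows "(znorm d x)\<^sup>2 = real (card {i\<in>{..<d}. odd (x i)}) + 4 * real (card {i\<in>{..<d}. x i = 2})"
proof -
  have "(znorm d x)\<^sup>2 = (\<Sum>i<d. (real_of_int (x i))\<^sup>2)"
    unfolding znorm_def L2_set_def by (intro real_sqrt_pow2 sum_nonneg) simp
  also have "\<dots> = (\<Sum>i<d. (if odd (x i) then 1 else 0) + 4 * (if x i = 2 then 1 else 0))"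
    using Zmd_4_values[OF x] by (intro sum.cong) fastforce+
  also have "\<dots> = real (card {i\<in>{..<d}. odd (x i)}) + 4 * real (card {i\<in>{..<d}. x i = 2})"
    by (simp add: sum.distrib sum.If_cases Int_def flip: sum_distrib_left)
  finally show ?thesis .
qed

lemma orbit_of_zero: "orbit_of 4 d (\<lambda>i\<in>{..<d}. 0) = orbit012 d 0 0"
proof -
  have "elem012 d 0 0 = (\<lambda>i\<in>{..<d}. 0)" by (auto simp: elem012_def)
  then show ?thesis by (simp add: orbit012_def)
qed

lemma lam_nonneg: "lam k Y \<ge> 0"
  by (simp add: lam_def)

theorem theorem9p1:
  fixes k :: nat
  assumes "k \<ge> 2"
  shows "\<exists>\<mu>. is_dft_transpose 4 (2 * k + 1) (lam k) \<mu> \<and>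
             dual_feasible 2 4 (2 * k + 1) \<mu> (lam k)"
proof -
  let ?d = "2 * k + 1"
  have k: "k > 0" using assms by simp
  define \<mu> where "\<mu> Y = Re (\<Sum>X\<in>orbits 4 ?d. sym_dft 4 ?d X Y * of_real (lam k X))" for Y
  have \<mu>_orbit: "\<mu> (orbit_of 4 ?d x) = 4 powr (- real ?d / 2) * real (card (orbit_of 4 ?d x)) * lam_spectrum k x"
    if x: "x \<in> Zmd 4 ?d" for x
    unfolding \<mu>_def using dft_transpose_lam[OF k orbit_of_in_orbits[OF x] mem_orbit_of[OF _ x]] by simp
  have transform: "is_dft_transpose 4 ?d (lam k) \<mu>"
    unfolding is_dft_transpose_def
  proof
    fix Y assume Y: "Y \<in> orbits 4 ?d"
    then obtain y where y: "y \<in> Y" using orbit_nonempty[OF _ Y] by auto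
    show "complex_of_real (\<mu> Y) = (\<Sum>X\<in>orbits 4 ?d. sym_dft 4 ?d X Y * complex_of_real (lam k X))"
      unfolding \<mu>_def dft_transpose_lam[OF k Y y] by simp
  qed
  have "dual_feasible 2 4 ?d \<mu> (lam k)"
    unfolding dual_feasible_def
  proof (intro conjI ballI impI)
    show "is_dft_transpose 4 ?d \<mu> (lam k)"
      by (rule is_dft_transpose_sym[OF _ transform]) simp
    show "lam k Y \<ge> 0" for Y by (rule lam_nonneg)
  next
    fix x assume x: "x \<in> Zmd 4 ?d"
    show "\<mu> (orbit_of 4 ?d x) \<ge> 0"
      unfolding \<mu>_orbit[OF x] lam_spectrum_def using lam_hat_nonneg[OF Zmd_4_counts[OF x]] by simp
  next
    fix x assume x: "x \<in> Zmd 4 ?d" and norm: "0 < znorm ?d x \<and> znorm ?d x < 2"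
    let ?a = "card {i\<in>{..<?d}. x i = 0}" and ?b = "card {i\<in>{..<?d}. odd (x i)}"
      and ?t = "card {i\<in>{..<?d}. x i = 2}"
    have "0 < (znorm ?d x)\<^sup>2" "(znorm ?d x)\<^sup>2 < 2\<^sup>2"
      using norm by (simp, intro power_strict_mono) auto
    then have "0 < real (?b + 4 * ?t)" "real (?b + 4 * ?t) < real 4"
      unfolding znorm_sq_Zmd_4[OF x] by simp_all
    then have bt: "0 < ?b + 4 * ?t" "?b + 4 * ?t < 4" by (simp_all only: of_nat_less_iff of_nat_0_less_iff)
    then have t: "?t = 0" by linarith
    have "lam_hat k ?a ?b ?t = 0"
    proof (cases "odd ?b")
      case True
      then show ?thesis using lam_hat_odd[OF Zmd_4_counts[OF x]] by blast
    next
      case False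
      then have b: "?b = 2" using bt t by presburger
      then have a: "?a = 2 * k - 1" using Zmd_4_counts[OF x] t by linarith
      show ?thesis unfolding a b t by (rule lam_hat_two[OF k])
    qed
    then show "\<mu> (orbit_of 4 ?d x) = 0" unfolding \<mu>_orbit[OF x] lam_spectrum_def by simp
  next
    let ?o = "\<lambda>i\<in>{..<?d}. 0 :: int"
    have o: "?o \<in> Zmd 4 ?d" by (simp add: Zmd_def centred_4)
    have "{i\<in>{..<?d}. ?o i = 0} = {..<?d}" "{i\<in>{..<?d}. ?o i = 2} = {}" "{i\<in>{..<?d}. odd (?o i)} = {}"
      by auto
    then have "lam_spectrum k ?o = 2 ^ (2 * k - 1) / (real k + 1) * (4 * (real k + 1))"
      unfolding lam_spectrum_def by (simp only: card_lessThan card.empty lam_hat_zero)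
    also have "\<dots> = 4 * 2 ^ (2 * k - 1)" by (simp add: field_simps)
    also have "\<dots> = 2 ^ ?d" using k by (cases k) simp_all
    finally have "lam_spectrum k ?o = 2 ^ ?d" .
    moreover have "card (orbit_of 4 ?d ?o) = 1"
      unfolding orbit_of_zero using card_orbit_zeros_twos[of ?d 0 ?d] by simp
    moreover have "4 powr (- real ?d / 2) * 2 ^ ?d = (1 :: real)"
    proof -
      have "(4 :: real) powr (- real ?d / 2) = 2 powr (- real ?d)"
        using powr_powr[of "2 :: real" 2 "- real ?d / 2"] by simp
      then show ?thesis by (simp only: powr_minus powr_realpow zero_less_numeral) simp
    qed
    ultimately show "\<mu> (orbit_of 4 ?d ?o) = (2 / 2) ^ ?d"
      unfolding \<mu>_orbit[OF o] by simp
  qed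
  with transform show ?thesis by blast
qed

end
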